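(* Consider a sequence of multiple testing problems indexed by the number of tests $m\to\infty$, with parameters $p=p_m$, $\tau^2=\tau_m^2$, $\sigma^2=\sigma_m^2$, $\delta_0=\delta_{0m}$, $\delta_A=\delta_{Am}$ such that, with $u=\tau^2/\sigma^2$, $f=(1-p)/p$, $\delta=\delta_0/\delta_A$ and $v=uf^2\delta^2$, as $m\to\infty$: $p\to 0$, $u\to\infty$, $v\to\infty$ and $\frac{\log v}{u}\to C\in(0,\infty)$. Suppose $p\propto m^{-\beta}$ with $0<\beta\le1$, and let $\alpha\in(0,1)$ be constant (not depending on $m$). Then the Benjamini–Hochberg procedure at FDR level $\alpha$ is ABOS if $\delta=\delta_m$ converges to $0$ in such a way that $\log\delta_m=o(\log m)$.
   Context: Model. Given a number of tests $m\ge 1$ and parameters $p\in(0,1)$, $\sigma^2>0$ (known), $\tau^2>0$, let $(\nu_i,X_i)$, $i=1,\dots,m$, be i.i.d. with $P(\nu_i=1)=p=1-P(\nu_i=0)$, $X_i\mid\nu_i=0\sim N(0,\sigma^2)$ and $X_i\mid\nu_i=1\sim N(0,\sigma^2+\tau^2)$. Only the $X_i$ are observed. The null hypothesis $H_{0i}$ is the event $\nu_i=0$, the alternative $H_{Ai}$ is $\nu_i=1$. A type I error (rejecting a true $H_{0i}$) costs $\delta_0>0$, a type II error (accepting $H_{0i}$ when $H_{Ai}$ holds) costs $\delta_A>0$, and the total loss is the sum over the $m$ tests. The Bayes risk of a multiple testing rule is $R=\delta_0E(V)+\delta_AE(T)$, where $V$ is the number of false rejections and $T$ the number of false acceptances.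 Bayes oracle: the rule minimizing $R$; it rejects $H_{0i}$ iff $X_i^2/\sigma^2\ge(1+\frac1u)\left(\log v+\log(1+\frac1u)\right)$, where $u=\tau^2/\sigma^2$, $f=(1-p)/p$, $\delta=\delta_0/\delta_A$, $v=uf^2\delta^2$. Its Bayes risk is denoted $R_{\mathrm{opt}}$. ABOS (asymptotically Bayes optimal under sparsity): a rule with risk $R$ is ABOS if $R/R_{\mathrm{opt}}\to1$ as $m\to\infty$. Benjamini–Hochberg procedure (BH) at FDR level $\alpha$: let $Z_i=|X_i|/\sigma$, $p_i=2(1-\Phi(Z_i))$ ($\Phi$ the standard normal cdf), $p_{(1)}\le\dots\le p_{(m)}$ the ordered $p$-values, and $k=\max\{i: p_{(i)}\le i\alpha/m\}$. BH rejects all null hypotheses whose $p$-value is at most $p_{(k)}$ (and rejects nothing if no such $i$ exists). $a_m\propto b_m$ means that $a_m/b_m$ converges to a constant in $(0,\infty)$. *)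

theory Defs
  imports "HOL-Probability.Probability" "HOL-Library.Landau_Symbols"
begin

definition normal_law :: "real \<Rightarrow> real measure" where
  "normal_law s = density lborel (\<lambda>x. ennreal (normal_density 0 s x))"

text \<open>
  Mixture model for \<open>m\<close> tests, indexed by \<open>1, \<dots>, m\<close>.  Here \<open>\<nu> i \<omega>\<close> means \<open>\<nu>\<^sub>i = 1\<close>, i.e. the
  \<open>i\<close>-th alternative holds; \<open>\<sigma>\<close> and \<open>\<tau>\<close> are the positive roots of the variances \<open>\<sigma>\<^sup>2\<close> and \<open>\<tau>\<^sup>2\<close>.
  The measure \<^term>\<open>uniform_measure M A\<close> is the conditional probability given the event \<open>A\<close>.
  The last three clauses determine the joint law of \<open>(\<nu>\<^sub>i, X\<^sub>i)\<close>, which is the same for all \<open>i\<close>.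
\<close>

definition mixture_model ::
  "nat \<Rightarrow> 'a measure \<Rightarrow> (nat \<Rightarrow> 'a \<Rightarrow> bool) \<Rightarrow> (nat \<Rightarrow> 'a \<Rightarrow> real) \<Rightarrow> real \<Rightarrow> real \<Rightarrow> real \<Rightarrow> bool" where
  "mixture_model m M \<nu> X p \<sigma> \<tau> \<longleftrightarrow>
     prob_space M \<and>
     prob_space.indep_vars M (\<lambda>_. count_space UNIV \<Otimes>\<^sub>M borel) (\<lambda>i \<omega>. (\<nu> i \<omega>, X i \<omega>)) {1..m} \<and>
     (\<forall>i\<in>{1..m}.
        measure M {\<omega> \<in> space M. \<nu> i \<omega>} = p \<and>
        distr (uniform_measure M {\<omega> \<in> space M. \<not> \<nu> i \<omega>}) borel (X i) = normal_law \<sigma> \<and>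
        distr (uniform_measure M {\<omega> \<in> space M. \<nu> i \<omega>}) borel (X i) = normal_law (sqrt (\<sigma>\<^sup>2 + \<tau>\<^sup>2)))"

text \<open>
  A multiple testing rule maps the data \<open>(x\<^sub>1, \<dots>, x\<^sub>m)\<close>, extended by \<^term>\<open>undefined\<close> outside
  \<open>{1..m}\<close>, to the set of the indices of the rejected null hypotheses.
\<close>

type_synonym testing_rule = "(nat \<Rightarrow> real) \<Rightarrow> nat set"

definition observations :: "nat \<Rightarrow> (nat \<Rightarrow> 'a \<Rightarrow> real) \<Rightarrow> 'a \<Rightarrow> nat \<Rightarrow> real" where
  "observations m X \<omega> = (\<lambda>i\<in>{1..m}. X i \<omega>)"

definition false_rejections ::
  "nat \<Rightarrow> (nat \<Rightarrow> 'a \<Rightarrow> bool) \<Rightarrow> (nat \<Rightarrow> 'a \<Rightarrow> real) \<Rightarrow> testing_rule \<Rightarrow> 'a \<Rightarrow> nat" where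
  "false_rejections m \<nu> X d \<omega> = card {i \<in> {1..m}. \<not> \<nu> i \<omega> \<and> i \<in> d (observations m X \<omega>)}"

definition false_acceptances ::
  "nat \<Rightarrow> (nat \<Rightarrow> 'a \<Rightarrow> bool) \<Rightarrow> (nat \<Rightarrow> 'a \<Rightarrow> real) \<Rightarrow> testing_rule \<Rightarrow> 'a \<Rightarrow> nat" where
  "false_acceptances m \<nu> X d \<omega> = card {i \<in> {1..m}. \<nu> i \<omega> \<and> i \<notin> d (observations m X \<omega>)}"

definition bayes_risk ::
  "nat \<Rightarrow> 'a measure \<Rightarrow> (nat \<Rightarrow> 'a \<Rightarrow> bool) \<Rightarrow> (nat \<Rightarrow> 'a \<Rightarrow> real) \<Rightarrow> real \<Rightarrow> real \<Rightarrow> testing_rule \<Rightarrow> real" where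
  "bayes_risk m M \<nu> X \<delta>\<^sub>0 \<delta>\<^sub>A d =
     \<delta>\<^sub>0 * (\<integral>\<omega>. real (false_rejections m \<nu> X d \<omega>) \<partial>M) +
     \<delta>\<^sub>A * (\<integral>\<omega>. real (false_acceptances m \<nu> X d \<omega>) \<partial>M)"

definition u_par :: "real \<Rightarrow> real \<Rightarrow> real" where
  "u_par \<sigma> \<tau> = \<tau>\<^sup>2 / \<sigma>\<^sup>2"

definition f_par :: "real \<Rightarrow> real" where
  "f_par p = (1 - p) / p"

definition v_par :: "real \<Rightarrow> real \<Rightarrow> real \<Rightarrow> real \<Rightarrow> real \<Rightarrow> real" where
  "v_par p \<sigma> \<tau> \<delta>\<^sub>0 \<delta>\<^sub>A = u_par \<sigma> \<tau> * (f_par p)\<^sup>2 * (\<delta>\<^sub>0 / \<delta>\<^sub>A)\<^sup>2"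

definition bayes_oracle :: "nat \<Rightarrow> real \<Rightarrow> real \<Rightarrow> real \<Rightarrow> real \<Rightarrow> real \<Rightarrow> testing_rule" where
  "bayes_oracle m p \<sigma> \<tau> \<delta>\<^sub>0 \<delta>\<^sub>A x =
     {i \<in> {1..m}. (x i)\<^sup>2 / \<sigma>\<^sup>2 \<ge>
        (1 + 1 / u_par \<sigma> \<tau>) * (ln (v_par p \<sigma> \<tau> \<delta>\<^sub>0 \<delta>\<^sub>A) + ln (1 + 1 / u_par \<sigma> \<tau>))}"

definition p_value :: "real \<Rightarrow> (nat \<Rightarrow> real) \<Rightarrow> nat \<Rightarrow> real" where
  "p_value \<sigma> x i = 2 * (1 - cdf std_normal_distribution (\<bar>x i\<bar> / \<sigma>))"

definition ordered_p_value :: "nat \<Rightarrow> real \<Rightarrow> (nat \<Rightarrow> real) \<Rightarrow> nat \<Rightarrow> real" where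
  "ordered_p_value m \<sigma> x j = sort (map (p_value \<sigma> x) [1..<Suc m]) ! (j - 1)"

definition BH_indices :: "nat \<Rightarrow> real \<Rightarrow> real \<Rightarrow> (nat \<Rightarrow> real) \<Rightarrow> nat set" where
  "BH_indices m \<alpha> \<sigma> x = {j \<in> {1..m}. ordered_p_value m \<sigma> x j \<le> real j * \<alpha> / real m}"

definition BH_rule :: "nat \<Rightarrow> real \<Rightarrow> real \<Rightarrow> testing_rule" where
  "BH_rule m \<alpha> \<sigma> x =
     (if BH_indices m \<alpha> \<sigma> x = {} then {}
      else {i \<in> {1..m}. p_value \<sigma> x i \<le> ordered_p_value m \<sigma> x (Max (BH_indices m \<alpha> \<sigma> x))})"

definition ABOS :: "(nat \<Rightarrow> real) \<Rightarrow> (nat \<Rightarrow> real) \<Rightarrow> bool" where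
  "ABOS R R_opt \<longleftrightarrow> (\<lambda>m. R m / R_opt m) \<longlonglongrightarrow> 1"

definition asymp_proportional :: "(nat \<Rightarrow> real) \<Rightarrow> (nat \<Rightarrow> real) \<Rightarrow> bool" where
  "asymp_proportional a b \<longleftrightarrow> (\<exists>c>0. (\<lambda>m. a m / b m) \<longlonglongrightarrow> c)"

text \<open>
  The rule \<^const>\<open>bayes_oracle\<close>, defined by its threshold, does minimise the Bayes risk among all
  measurable rules (lemma \<open>bayes_oracle_minimizes_risk\<close> below).
\<close>

definition measurable_rule :: "nat \<Rightarrow> testing_rule \<Rightarrow> bool" where
  "measurable_rule m d \<longleftrightarrow>
     (\<forall>i\<in>{1..m}. {x \<in> space (\<Pi>\<^sub>M i\<in>{1..m}. borel). i \<in> d x} \<in> sets (\<Pi>\<^sub>M i\<in>{1..m}. (borel :: real measure)))"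

lemma measurable_rule_bayes_oracle: "measurable_rule m (bayes_oracle m p \<sigma> \<tau> \<delta>\<^sub>0 \<delta>\<^sub>A)"
  unfolding measurable_rule_def bayes_oracle_def by auto

lemma oracle_threshold_iff:
  assumes p: "0 < p" "p < 1" and pos: "\<sigma> > 0" "\<tau> > 0" "\<delta>\<^sub>0 > 0" "\<delta>\<^sub>A > (0::real)"
  shows "(1 + 1 / u_par \<sigma> \<tau>) * (ln (v_par p \<sigma> \<tau> \<delta>\<^sub>0 \<delta>\<^sub>A) + ln (1 + 1 / u_par \<sigma> \<tau>)) \<le> x\<^sup>2 / \<sigma>\<^sup>2 \<longleftrightarrow>
    \<delta>\<^sub>0 * (1 - p) * normal_density 0 \<sigma> x \<le> \<delta>\<^sub>A * p * normal_density 0 (sqrt (\<sigma>\<^sup>2 + \<tau>\<^sup>2)) x"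
proof -
  define s where "s = \<sigma>\<^sup>2"
  define t where "t = \<tau>\<^sup>2"
  have s: "s > 0" "t > 0" using pos by (auto simp: s_def t_def)
  define a where "a = \<delta>\<^sub>0 * (1 - p)"
  define b where "b = \<delta>\<^sub>A * p"
  have ab: "a > 0" "b > 0" using p pos by (auto simp: a_def b_def)
  have u: "u_par \<sigma> \<tau> = t / s" by (simp add: u_par_def s_def t_def)
  have v: "v_par p \<sigma> \<tau> \<delta>\<^sub>0 \<delta>\<^sub>A = t / s * (a / b)\<^sup>2"
  proof -
    have "a / b = (1 - p) / p * (\<delta>\<^sub>0 / \<delta>\<^sub>A)" by (simp add: a_def b_def mult.commute)
    then show ?thesis by (simp only: v_par_def u f_par_def power_mult_distrib mult.assoc)
  qed
  have n0: "normal_density 0 \<sigma> x = exp (- x\<^sup>2 / (2 * s) - ln (2 * pi * s) / 2)"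
    using s by (simp add: normal_density_def s_def[symmetric] exp_diff powr_half_sqrt[symmetric] powr_def)
  have n1: "normal_density 0 (sqrt (\<sigma>\<^sup>2 + \<tau>\<^sup>2)) x = exp (- x\<^sup>2 / (2 * (s + t)) - ln (2 * pi * (s + t)) / 2)"
  proof -
    have "(sqrt (s + t))\<^sup>2 = s + t" using s by simp
    then show ?thesis using s
      by (simp add: normal_density_def s_def[symmetric] t_def[symmetric] exp_diff powr_half_sqrt[symmetric, of "2 * pi * (s + t)"] powr_def)
  qed
  have "a * normal_density 0 \<sigma> x \<le> b * normal_density 0 (sqrt (\<sigma>\<^sup>2 + \<tau>\<^sup>2)) x \<longleftrightarrow>
     exp (ln a + (- x\<^sup>2 / (2 * s) - ln (2 * pi * s) / 2)) \<le> exp (ln b + (- x\<^sup>2 / (2 * (s + t)) - ln (2 * pi * (s + t)) / 2))"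
    unfolding n0 n1 exp_add using ab by simp
  also have "\<dots> \<longleftrightarrow> 2 * ln a - 2 * ln b + ln (s + t) - ln s \<le> x\<^sup>2 / s - x\<^sup>2 / (s + t)"
  proof -
    have "x\<^sup>2 / (2 * s) = (x\<^sup>2 / s) / 2" "x\<^sup>2 / (2 * (s + t)) = (x\<^sup>2 / (s + t)) / 2" by simp_all
    moreover have "ln (2 * pi * s) = ln (2 * pi) + ln s" "ln (2 * pi * (s + t)) = ln (2 * pi) + ln (s + t)"
      using s by (simp_all add: ln_mult)
    moreover have "la + (- h1 - l1 / 2) \<le> lb + (- h2 - l2 / 2) \<longleftrightarrow> 2 * la - 2 * lb + L2 - L1 \<le> H1 - H2"
      if "h1 = H1 / 2" "h2 = H2 / 2" "l1 = k + L1" "l2 = k + L2" for la lb h1 h2 l1 l2 H1 H2 L1 L2 k :: real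
      using that by (auto simp: field_simps)
    ultimately show ?thesis unfolding exp_le_cancel_iff minus_divide_left[symmetric] by blast
  qed
  also have "x\<^sup>2 / s - x\<^sup>2 / (s + t) = x\<^sup>2 / s * (t / (s + t))"
    using s by (simp add: divide_simps) (simp add: algebra_simps)
  also have "2 * ln a - 2 * ln b + ln (s + t) - ln s = ln (t / s * (a / b)\<^sup>2) + ln (1 + s / t)"
  proof -
    have "1 + s / t = (s + t) / t" using s by (simp add: divide_simps)
    then show ?thesis using s ab by (simp add: ln_mult ln_div ln_realpow)
  qed
  also have "ln (t / s * (a / b)\<^sup>2) + ln (1 + s / t) \<le> x\<^sup>2 / s * (t / (s + t)) \<longleftrightarrow>
     (1 + s / t) * (ln (t / s * (a / b)\<^sup>2) + ln (1 + s / t)) \<le> x\<^sup>2 / s"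
  proof -
    have e: "1 + s / t = (s + t) / t" using s by (simp add: divide_simps)
    have "y \<le> z * (t / (s + t)) \<longleftrightarrow> (s + t) / t * y \<le> z" for y z :: real
      using s by (simp add: field_simps)
    then show ?thesis unfolding e .
  qed
  finally show ?thesis using s unfolding u v a_def b_def by (simp add: s_def)
qed

lemma bayes_oracle_minimizes_risk:
  assumes p: "0 < p" "p < 1" and pos: "\<sigma> > 0" "\<tau> > 0" "\<delta>\<^sub>0 > 0" "\<delta>\<^sub>A > 0"
    and model: "mixture_model m M \<nu> X p \<sigma> \<tau>"
    and d: "measurable_rule m d"
  shows "bayes_risk m M \<nu> X \<delta>\<^sub>0 \<delta>\<^sub>A (bayes_oracle m p \<sigma> \<tau> \<delta>\<^sub>0 \<delta>\<^sub>A) \<le> bayes_risk m M \<nu> X \<delta>\<^sub>0 \<delta>\<^sub>A d"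
proof -
  interpret prob_space M using model by (simp add: mixture_model_def)
  let ?I = "{1..m}"
  let ?N = "count_space UNIV \<Otimes>\<^sub>M borel :: (bool \<times> real) measure"
  let ?P = "\<Pi>\<^sub>M i\<in>?I. (borel :: real measure)"
  let ?W = "\<lambda>i \<omega>. (\<nu> i \<omega>, X i \<omega>)"
  let ?O = "bayes_oracle m p \<sigma> \<tau> \<delta>\<^sub>0 \<delta>\<^sub>A"
  have ind: "indep_vars (\<lambda>_. ?N) ?W ?I" using model by (simp add: mixture_model_def)
  have Wm: "?W i \<in> M \<rightarrow>\<^sub>M ?N" if "i \<in> ?I" for i
    using ind that by (auto simp: indep_vars_def)
  have num: "\<nu> i \<in> M \<rightarrow>\<^sub>M count_space UNIV" if "i \<in> ?I" for i
    using measurable_compose[OF Wm[OF that] measurable_fst] by simp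
  have Xm: "X i \<in> borel_measurable M" if "i \<in> ?I" for i
    using measurable_compose[OF Wm[OF that] measurable_snd] by simp
  have obs[measurable]: "observations m X \<in> M \<rightarrow>\<^sub>M ?P"
    unfolding observations_def by (intro measurable_restrict Xm)

  define c0 where "c0 = \<delta>\<^sub>0 * (1 - p)"
  define c1 where "c1 = \<delta>\<^sub>A * p"
  have c: "c0 > 0" "c1 > 0" using p pos by (auto simp: c0_def c1_def)
  define g where "g x = min (c0 * normal_density 0 \<sigma> x) (c1 * normal_density 0 (sqrt (\<sigma>\<^sup>2 + \<tau>\<^sup>2)) x)" for x
  define L where "L = (\<integral>\<^sup>+x. ennreal (g x) \<partial>lborel)"

  define cost where "cost D i = \<delta>\<^sub>0 * prob {\<omega> \<in> space M. \<not> \<nu> i \<omega> \<and> i \<in> D (observations m X \<omega>)} +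
     \<delta>\<^sub>A * prob {\<omega> \<in> space M. \<nu> i \<omega> \<and> i \<notin> D (observations m X \<omega>)}" for D i

  have pm: "Measurable.pred ?P (\<lambda>x. i \<in> D x)" if "measurable_rule m D" "i \<in> ?I" for D i
    using that unfolding measurable_rule_def pred_def by blast

  have risk: "bayes_risk m M \<nu> X \<delta>\<^sub>0 \<delta>\<^sub>A D = (\<Sum>i\<in>?I. cost D i)" if D: "measurable_rule m D" for D
  proof -
    have ev: "{\<omega> \<in> space M. Q (\<nu> i \<omega>) (i \<in> D (observations m X \<omega>))} \<in> sets M" if i: "i \<in> ?I" for i Q
    proof -
      have [measurable]: "Measurable.pred ?P (\<lambda>x. i \<in> D x)" by (rule pm[OF D i])
      have [measurable]: "\<nu> i \<in> M \<rightarrow>\<^sub>M count_space UNIV" by (rule num[OF i])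
      have [measurable]: "(\<lambda>\<omega>. i \<in> D (observations m X \<omega>)) \<in> M \<rightarrow>\<^sub>M count_space UNIV"
        by (rule measurable_compose[OF obs]) measurable
      have "Measurable.pred M (\<lambda>\<omega>. (\<lambda>b. Q (fst b) (snd b)) (\<nu> i \<omega>, i \<in> D (observations m X \<omega>)))"
      proof (rule measurable_compose[where N = "count_space UNIV \<Otimes>\<^sub>M count_space UNIV"])
        show "(\<lambda>\<omega>. (\<nu> i \<omega>, i \<in> D (observations m X \<omega>))) \<in> M \<rightarrow>\<^sub>M count_space UNIV \<Otimes>\<^sub>M count_space UNIV"
          by measurable
        show "Measurable.pred (count_space UNIV \<Otimes>\<^sub>M count_space UNIV) (\<lambda>b :: bool \<times> bool. Q (fst b) (snd b))"
          by (simp add: pair_measure_countable)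
      qed
      then show ?thesis by (simp add: pred_def)
    qed
    have E: "(\<integral>\<omega>. real (card {i\<in>?I. Q (\<nu> i \<omega>) (i \<in> D (observations m X \<omega>))}) \<partial>M) =
       (\<Sum>i\<in>?I. prob {\<omega>\<in>space M. Q (\<nu> i \<omega>) (i \<in> D (observations m X \<omega>))})" for Q
    proof -
      let ?A = "\<lambda>i. {\<omega>\<in>space M. Q (\<nu> i \<omega>) (i \<in> D (observations m X \<omega>))}"
      have "(\<integral>\<omega>. real (card {i\<in>?I. Q (\<nu> i \<omega>) (i \<in> D (observations m X \<omega>))}) \<partial>M) =
         (\<integral>\<omega>. (\<Sum>i\<in>?I. indicat_real (?A i) \<omega>) \<partial>M)"
      proof (intro Bochner_Integration.integral_cong refl)
        fix \<omega> assume "\<omega> \<in> space M"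
        then have "(\<Sum>i\<in>?I. indicat_real (?A i) \<omega>) = (\<Sum>i\<in>?I. if Q (\<nu> i \<omega>) (i \<in> D (observations m X \<omega>)) then 1 else 0)"
          by (intro sum.cong) (simp_all add: indicator_def)
        then show "real (card {i\<in>?I. Q (\<nu> i \<omega>) (i \<in> D (observations m X \<omega>))}) = (\<Sum>i\<in>?I. indicat_real (?A i) \<omega>)"
          by (simp add: sum.inter_filter[symmetric])
      qed
      also have "\<dots> = (\<Sum>i\<in>?I. prob (?A i))"
        using ev by (subst Bochner_Integration.integral_sum) (auto simp: less_top[symmetric])
      finally show ?thesis .
    qed
    show ?thesis
      unfolding bayes_risk_def false_rejections_def false_acceptances_def cost_def
      using E[of "\<lambda>a b. \<not> a \<and> b"] E[of "\<lambda>a b. a \<and> \<not> b"]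
      by (simp add: sum.distrib sum_distrib_left)
  qed

  have law: "emeasure M {\<omega>\<in>space M. \<nu> i \<omega> = b \<and> X i \<omega> \<in> A} =
      ennreal (if b then p else 1 - p) * emeasure (normal_law (if b then sqrt (\<sigma>\<^sup>2 + \<tau>\<^sup>2) else \<sigma>)) A"
    if i: "i \<in> ?I" and A: "A \<in> sets borel" for i b A
  proof -
    note [measurable] = num[OF i] Xm[OF i] A
    let ?B = "{\<omega>\<in>space M. \<nu> i \<omega> = b}"
    have B: "?B \<in> sets M" by measurable
    have p1: "prob {\<omega>\<in>space M. \<nu> i \<omega>} = p" using model i by (simp add: mixture_model_def)
    have p0: "prob {\<omega>\<in>space M. \<not> \<nu> i \<omega>} = 1 - p"
    proof -
      have "{\<omega>\<in>space M. \<nu> i \<omega>} \<in> sets M" by measurable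
      from prob_neg[OF this] show ?thesis using p1 by simp
    qed
    have pB: "emeasure M ?B = ennreal (if b then p else 1 - p)"
      using p0 p1 by (cases b) (simp_all add: emeasure_eq_measure)
    have "distr (uniform_measure M ?B) borel (X i) = normal_law (if b then sqrt (\<sigma>\<^sup>2 + \<tau>\<^sup>2) else \<sigma>)"
      using model i by (cases b) (simp_all add: mixture_model_def)
    then have "emeasure (normal_law (if b then sqrt (\<sigma>\<^sup>2 + \<tau>\<^sup>2) else \<sigma>)) A =
      emeasure (distr (uniform_measure M ?B) borel (X i)) A" by simp
    also have "\<dots> = emeasure M (?B \<inter> (X i -` A \<inter> space M)) / emeasure M ?B"
      using B by (subst emeasure_distr) (auto simp: measurable_def intro!: emeasure_uniform_measure)
    also have "?B \<inter> (X i -` A \<inter> space M) = {\<omega>\<in>space M. \<nu> i \<omega> = b \<and> X i \<omega> \<in> A}" by auto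
    finally have "emeasure (normal_law (if b then sqrt (\<sigma>\<^sup>2 + \<tau>\<^sup>2) else \<sigma>)) A =
        emeasure M {\<omega>\<in>space M. \<nu> i \<omega> = b \<and> X i \<omega> \<in> A} / ennreal (if b then p else 1 - p)"
      by (simp only: pB)
    moreover have "ennreal q * (e / ennreal q) = e" if "q > 0" for q e
      using that by (simp add: ennreal_times_divide mult.commute[of "ennreal q"] mult_divide_eq_ennreal)
    ultimately show ?thesis using p by auto
  qed

  have two: "ennreal \<delta>\<^sub>0 * (ennreal (1 - p) * emeasure (normal_law \<sigma>) A) +
        ennreal \<delta>\<^sub>A * (ennreal p * emeasure (normal_law (sqrt (\<sigma>\<^sup>2 + \<tau>\<^sup>2))) (- A)) =
      (\<integral>\<^sup>+x. ennreal (if x \<in> A then c0 * normal_density 0 \<sigma> x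
                      else c1 * normal_density 0 (sqrt (\<sigma>\<^sup>2 + \<tau>\<^sup>2)) x) \<partial>lborel)"
    if A[measurable]: "A \<in> sets borel" for A
  proof -
    have "ennreal \<delta>\<^sub>0 * (ennreal (1 - p) * emeasure (normal_law \<sigma>) A) =
       (\<integral>\<^sup>+x. ennreal c0 * (ennreal (normal_density 0 \<sigma> x) * indicator A x) \<partial>lborel)"
      using p pos unfolding normal_law_def c0_def
      by (simp add: emeasure_density nn_integral_cmult ennreal_mult mult.assoc)
    moreover have "ennreal \<delta>\<^sub>A * (ennreal p * emeasure (normal_law (sqrt (\<sigma>\<^sup>2 + \<tau>\<^sup>2))) (- A)) =
       (\<integral>\<^sup>+x. ennreal c1 * (ennreal (normal_density 0 (sqrt (\<sigma>\<^sup>2 + \<tau>\<^sup>2)) x) * indicator (- A) x) \<partial>lborel)"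
      using p pos A unfolding normal_law_def c1_def
      by (simp add: emeasure_density nn_integral_cmult ennreal_mult mult.assoc borel_comp)
    ultimately show ?thesis using c A
      by (simp add: nn_integral_add[symmetric] borel_comp)
         (auto intro!: nn_integral_cong simp: ennreal_mult split: split_indicator)
  qed

  have cost: "ennreal (cost D i) = (\<integral>\<^sup>+y. (\<integral>\<^sup>+x. ennreal (if i \<in> D (y(i := x)) then c0 * normal_density 0 \<sigma> x
                      else c1 * normal_density 0 (sqrt (\<sigma>\<^sup>2 + \<tau>\<^sup>2)) x) \<partial>lborel)
        \<partial>distr M (\<Pi>\<^sub>M j\<in>?I - {i}. borel) (\<lambda>\<omega>. \<lambda>j\<in>?I - {i}. X j \<omega>))"
    if D: "measurable_rule m D" and i: "i \<in> ?I" for D i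
  proof -
    let ?J = "?I - {i}"
    let ?R = "\<Pi>\<^sub>M j\<in>?J. (borel :: real measure)"
    let ?Y = "\<lambda>\<omega>. \<lambda>j\<in>?J. X j \<omega>"
    let ?A' = "\<lambda>\<omega>. restrict (\<lambda>i. ?W i \<omega>) {i}"
    let ?B' = "\<lambda>\<omega>. restrict (\<lambda>i. ?W i \<omega>) ?J"
    have "indep_var (PiM {i} (\<lambda>_. ?N)) (\<lambda>\<omega>. restrict (\<lambda>i. ?W i \<omega>) {i})
        (PiM ?J (\<lambda>_. ?N)) (\<lambda>\<omega>. restrict (\<lambda>i. ?W i \<omega>) ?J)"
      using i by (intro indep_var_restrict[OF ind]) auto
    then have A'm: "?A' \<in> M \<rightarrow>\<^sub>M PiM {i} (\<lambda>_. ?N)" and B'm: "?B' \<in> M \<rightarrow>\<^sub>M PiM ?J (\<lambda>_. ?N)"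
      and joint': "distr M (PiM {i} (\<lambda>_. ?N)) ?A' \<Otimes>\<^sub>M distr M (PiM ?J (\<lambda>_. ?N)) ?B' =
        distr M (PiM {i} (\<lambda>_. ?N) \<Otimes>\<^sub>M PiM ?J (\<lambda>_. ?N)) (\<lambda>\<omega>. (?A' \<omega>, ?B' \<omega>))"
      unfolding indep_var_distribution_eq by auto
    let ?g = "\<lambda>h :: nat \<Rightarrow> bool \<times> real. \<lambda>j\<in>?J. snd (h j)"
    have f: "(\<lambda>h. h i) \<in> PiM {i} (\<lambda>_. ?N) \<rightarrow>\<^sub>M ?N" by (rule measurable_component_singleton) simp
    have g: "?g \<in> PiM ?J (\<lambda>_. ?N) \<rightarrow>\<^sub>M ?R"
      by (intro measurable_restrict measurable_compose[OF _ measurable_snd[of "count_space UNIV" borel]]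
            measurable_component_singleton)
    have A'W: "(\<lambda>h. h i) \<circ> ?A' = ?W i" by auto
    have B'Y: "?g \<circ> ?B' = ?Y" by (auto simp: fun_eq_iff)
    have Ym[measurable]: "?Y \<in> M \<rightarrow>\<^sub>M ?R"
      by (intro measurable_restrict Xm) auto
    have dW: "distr M ?N (?W i) = distr (distr M (PiM {i} (\<lambda>_. ?N)) ?A') ?N (\<lambda>h. h i)"
      using distr_distr[OF f A'm] unfolding A'W by simp
    have dY: "distr M ?R ?Y = distr (distr M (PiM ?J (\<lambda>_. ?N)) ?B') ?R ?g"
      using distr_distr[OF g B'm] unfolding B'Y by simp
    have joint: "distr M ?N (?W i) \<Otimes>\<^sub>M distr M ?R ?Y = distr M (?N \<Otimes>\<^sub>M ?R) (\<lambda>\<omega>. (?W i \<omega>, ?Y \<omega>))"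
    proof -
      have "sigma_finite_measure (distr M ?R ?Y)"
        by (intro prob_space_imp_sigma_finite prob_space_distr Ym)
      then have "distr M ?N (?W i) \<Otimes>\<^sub>M distr M ?R ?Y =
        distr (distr M (PiM {i} (\<lambda>_. ?N)) ?A' \<Otimes>\<^sub>M distr M (PiM ?J (\<lambda>_. ?N)) ?B') (?N \<Otimes>\<^sub>M ?R) (\<lambda>(x, y). (x i, ?g y))"
        unfolding dW dY using f g by (intro pair_measure_distr) auto
      also have "\<dots> = distr M (?N \<Otimes>\<^sub>M ?R) ((\<lambda>(x, y). (x i, ?g y)) \<circ> (\<lambda>\<omega>. (?A' \<omega>, ?B' \<omega>)))"
        unfolding joint'
      proof (rule distr_distr)
        show "(\<lambda>\<omega>. (?A' \<omega>, ?B' \<omega>)) \<in> M \<rightarrow>\<^sub>M PiM {i} (\<lambda>_. ?N) \<Otimes>\<^sub>M PiM ?J (\<lambda>_. ?N)"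
          using A'm B'm by (rule measurable_Pair)
        show "(\<lambda>(x, y). (x i, ?g y)) \<in> PiM {i} (\<lambda>_. ?N) \<Otimes>\<^sub>M PiM ?J (\<lambda>_. ?N) \<rightarrow>\<^sub>M ?N \<Otimes>\<^sub>M ?R"
          unfolding split_beta
          by (intro measurable_Pair measurable_compose[OF measurable_fst f] measurable_compose[OF measurable_snd g])
      qed
      also have "(\<lambda>(x, y). (x i, ?g y)) \<circ> (\<lambda>\<omega>. (?A' \<omega>, ?B' \<omega>)) = (\<lambda>\<omega>. (?W i \<omega>, ?Y \<omega>))"
        by (auto simp: fun_eq_iff)
      finally show ?thesis .
    qed
    note [measurable] = Wm[OF i] num[OF i] Xm[OF i]
    interpret A: prob_space "distr M ?N (?W i)" by (rule prob_space_distr) measurable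
    interpret B: prob_space "distr M ?R ?Y" by (rule prob_space_distr) measurable
    interpret AB: pair_sigma_finite "distr M ?N (?W i)" "distr M ?R ?Y" ..

    have upd: "(\<lambda>z. (snd z)(i := fst z)) \<in> borel \<Otimes>\<^sub>M ?R \<rightarrow>\<^sub>M ?P"
    proof -
      have "(\<lambda>z. (snd z)(i := fst z)) \<in> borel \<Otimes>\<^sub>M ?R \<rightarrow>\<^sub>M Pi\<^sub>M (insert i ?J) (\<lambda>_. borel :: real measure)"
        by (rule measurable_fun_upd[where J = ?J]) auto
      then show ?thesis using i by (simp add: insert_absorb)
    qed
    have Dupd: "Measurable.pred (borel \<Otimes>\<^sub>M ?R) (\<lambda>z. i \<in> D ((snd z)(i := fst z)))"
      by (rule measurable_compose[OF upd pm[OF D i]])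
    have slice: "{x. i \<in> D (y(i := x))} \<in> sets borel" if "y \<in> space ?R" for y
    proof -
      have "(\<lambda>x. (x, y)) \<in> borel \<rightarrow>\<^sub>M borel \<Otimes>\<^sub>M ?R" using that by measurable
      from measurable_compose[OF this Dupd] show ?thesis by (simp add: pred_def)
    qed
    have Yi: "observations m X \<omega> = (?Y \<omega>)(i := X i \<omega>)" for \<omega>
      using i by (auto simp: observations_def fun_eq_iff)

    have main: "emeasure M {\<omega>\<in>space M. \<nu> i \<omega> = b \<and> (i \<in> D (observations m X \<omega>)) = e} =
       (\<integral>\<^sup>+y. emeasure M {\<omega>\<in>space M. \<nu> i \<omega> = b \<and> X i \<omega> \<in> {x. (i \<in> D (y(i := x))) = e}} \<partial>distr M ?R ?Y)" for b e
    proof -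
      let ?E = "{z \<in> space (?N \<Otimes>\<^sub>M ?R). fst (fst z) = b \<and> (i \<in> D ((snd z)(i := snd (fst z)))) = e}"
      have "(\<lambda>z. (snd (fst z), snd z)) \<in> ?N \<Otimes>\<^sub>M ?R \<rightarrow>\<^sub>M borel \<Otimes>\<^sub>M ?R" by measurable
      from measurable_compose[OF this Dupd]
      have [measurable]: "Measurable.pred (?N \<Otimes>\<^sub>M ?R) (\<lambda>z. i \<in> D ((snd z)(i := snd (fst z))))" by simp
      have WY: "(\<lambda>\<omega>. (?W i \<omega>, ?Y \<omega>)) \<in> M \<rightarrow>\<^sub>M ?N \<Otimes>\<^sub>M ?R"
        by (intro measurable_Pair Wm[OF i] Ym)
      have E: "?E \<in> sets (?N \<Otimes>\<^sub>M ?R)" by measurable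
      have "emeasure M {\<omega>\<in>space M. \<nu> i \<omega> = b \<and> (i \<in> D (observations m X \<omega>)) = e} =
         emeasure (distr M (?N \<Otimes>\<^sub>M ?R) (\<lambda>\<omega>. (?W i \<omega>, ?Y \<omega>))) ?E"
        by (subst emeasure_distr[OF WY E])
          (auto simp: Yi space_pair_measure space_PiM intro!: arg_cong[where f = "emeasure M"])
      also have "\<dots> = (\<integral>\<^sup>+y. emeasure (distr M ?N (?W i)) ((\<lambda>x. (x, y)) -` ?E) \<partial>distr M ?R ?Y)"
        unfolding joint[symmetric] using E by (intro AB.emeasure_pair_measure_alt2) simp
      also have "\<dots> = (\<integral>\<^sup>+y. emeasure M {\<omega>\<in>space M. \<nu> i \<omega> = b \<and> X i \<omega> \<in> {x. (i \<in> D (y(i := x))) = e}} \<partial>distr M ?R ?Y)"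
      proof (rule nn_integral_cong)
        fix y assume "y \<in> space (distr M ?R ?Y)"
        then have y: "y \<in> space ?R" by simp
        show "emeasure (distr M ?N (?W i)) ((\<lambda>x. (x, y)) -` ?E) =
          emeasure M {\<omega>\<in>space M. \<nu> i \<omega> = b \<and> X i \<omega> \<in> {x. (i \<in> D (y(i := x))) = e}}"
          using sets_Pair2[OF E, of y] y
          by (subst emeasure_distr)
             (auto simp: space_pair_measure intro!: arg_cong[where f = "emeasure M"])
      qed
      finally show ?thesis .
    qed
    have sec: "(\<lambda>y. emeasure M {\<omega>\<in>space M. \<nu> i \<omega> = b \<and> X i \<omega> \<in> {x. (i \<in> D (y(i := x))) = e}})
        \<in> borel_measurable (distr M ?R ?Y)" for b e
    proof -
      have "(\<lambda>z. (X i (snd z), fst z)) \<in> ?R \<Otimes>\<^sub>M M \<rightarrow>\<^sub>M borel \<Otimes>\<^sub>M ?R" by measurable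
      from measurable_compose[OF this Dupd]
      have [measurable]: "Measurable.pred (?R \<Otimes>\<^sub>M M) (\<lambda>z. i \<in> D ((fst z)(i := X i (snd z))))" by simp
      let ?Q = "{z\<in>space (?R \<Otimes>\<^sub>M M). \<nu> i (snd z) = b \<and> (i \<in> D ((fst z)(i := X i (snd z)))) = e}"
      have "?Q \<in> sets (?R \<Otimes>\<^sub>M M)" by measurable
      then have "(\<lambda>y. emeasure M (Pair y -` ?Q)) \<in> borel_measurable ?R" by (rule measurable_emeasure_Pair)
      also have "?this \<longleftrightarrow> (\<lambda>y. emeasure M {\<omega>\<in>space M. \<nu> i \<omega> = b \<and> X i \<omega> \<in> {x. (i \<in> D (y(i := x))) = e}})
        \<in> borel_measurable ?R"
        by (intro measurable_cong arg_cong[where f = "emeasure M"]) (auto simp: space_pair_measure)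
      finally show ?thesis by simp
    qed
    have "ennreal (cost D i) = ennreal \<delta>\<^sub>0 * emeasure M {\<omega>\<in>space M. \<nu> i \<omega> = False \<and> (i \<in> D (observations m X \<omega>)) = True} +
       ennreal \<delta>\<^sub>A * emeasure M {\<omega>\<in>space M. \<nu> i \<omega> = True \<and> (i \<in> D (observations m X \<omega>)) = False}"
      unfolding cost_def emeasure_eq_measure using pos by (simp add: ennreal_mult)
    also have "\<dots> = (\<integral>\<^sup>+y. ennreal \<delta>\<^sub>0 * emeasure M {\<omega>\<in>space M. \<nu> i \<omega> = False \<and> X i \<omega> \<in> {x. (i \<in> D (y(i := x))) = True}} +
         ennreal \<delta>\<^sub>A * emeasure M {\<omega>\<in>space M. \<nu> i \<omega> = True \<and> X i \<omega> \<in> {x. (i \<in> D (y(i := x))) = False}} \<partial>distr M ?R ?Y)"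
      unfolding main using sec by (subst nn_integral_add) (auto simp only: nn_integral_cmult intro!: borel_measurable_times_ennreal borel_measurable_const)
    also have "\<dots> = (\<integral>\<^sup>+y. (\<integral>\<^sup>+x. ennreal (if i \<in> D (y(i := x)) then c0 * normal_density 0 \<sigma> x
                      else c1 * normal_density 0 (sqrt (\<sigma>\<^sup>2 + \<tau>\<^sup>2)) x) \<partial>lborel) \<partial>distr M ?R ?Y)"
    proof (rule nn_integral_cong)
      fix y assume "y \<in> space (distr M ?R ?Y)"
      then have S: "{x. i \<in> D (y(i := x))} \<in> sets borel" using slice by simp
      have S': "{x. (i \<in> D (y(i := x))) = True} = {x. i \<in> D (y(i := x))}"
        "{x. (i \<in> D (y(i := x))) = False} = - {x. i \<in> D (y(i := x))}" by auto
      show "ennreal \<delta>\<^sub>0 * emeasure M {\<omega>\<in>space M. \<nu> i \<omega> = False \<and> X i \<omega> \<in> {x. (i \<in> D (y(i := x))) = True}} +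
         ennreal \<delta>\<^sub>A * emeasure M {\<omega>\<in>space M. \<nu> i \<omega> = True \<and> X i \<omega> \<in> {x. (i \<in> D (y(i := x))) = False}} =
        (\<integral>\<^sup>+x. ennreal (if i \<in> D (y(i := x)) then c0 * normal_density 0 \<sigma> x
                      else c1 * normal_density 0 (sqrt (\<sigma>\<^sup>2 + \<tau>\<^sup>2)) x) \<partial>lborel)"
        unfolding S' law[OF i S] law[OF i borel_comp[OF S]] using two[OF S] by simp
    qed
    finally show ?thesis .
  qed

  have "cost ?O i \<le> cost D i" if D: "measurable_rule m D" and i: "i \<in> ?I" for D i
  proof -
    have O: "i \<in> ?O (y(i := x)) \<longleftrightarrow>
        c0 * normal_density 0 \<sigma> x \<le> c1 * normal_density 0 (sqrt (\<sigma>\<^sup>2 + \<tau>\<^sup>2)) x" for x y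
      using i oracle_threshold_iff[OF p pos, of x] by (simp add: bayes_oracle_def c0_def c1_def)
    have "ennreal (cost ?O i) \<le> ennreal (cost D i)"
      unfolding cost[OF measurable_rule_bayes_oracle i] cost[OF D i] O
      using c by (intro nn_integral_mono ennreal_leI) auto
    moreover have "cost D i \<ge> 0" using pos by (simp add: cost_def)
    ultimately show ?thesis by (simp add: ennreal_le_iff)
  qed
  then show ?thesis
    unfolding risk[OF d] risk[OF measurable_rule_bayes_oracle] by (intro sum_mono) (use d in auto)
qed

end

theory Submission
  imports Defs
begin

text \<open>
  Let \<open>H a\<close> be the probability that a standard normal variable is smaller than \<open>a\<close> in absolute
  value (\<open>central_mass\<close> below).  Divided by \<open>\<delta>\<^sub>A m p\<close>, the oracle risk is at least its type II part, which is
  \<open>H (c / sqrt (1 + u))\<close> with \<open>c\<close> the oracle threshold, and \<open>c\<^sup>2 / (1 + u)\<close> tends to \<open>C\<close>.  As the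
  oracle minimises the risk, it suffices to bound the normalised risk of the step-up rule from
  above by a quantity with the same limit \<open>H (sqrt C) > 0\<close>.

  Type I errors.  Let \<open>r(A)\<close> be the expected number of rejections after the p-values with index
  in \<open>A\<close> have been set to \<open>0\<close>.  A true null \<open>i \<notin> A\<close> is rejected only if its p-value is at most
  \<open>\<alpha> / m\<close> times the number of rejections for \<open>insert i A\<close>, which is independent of \<open>X\<^sub>i\<close>; therefore
  \<open>r(A) \<le> card A + m p + \<alpha> max\<^sub>i r(insert i A)\<close>.  Solving this recursion downward from \<open>A = {1..m}\<close>
  gives \<open>r({}) \<le> m p / (1 - \<alpha>) + \<alpha> / (1 - \<alpha>)\<^sup>2\<close>
  (\<open>expectation_rejections_zeroing_le\<close>).  Since \<open>m p\<close> is bounded away from \<open>0\<close>, the number of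
  false rejections is \<open>O(m p)\<close> in expectation, and its normalised cost is \<open>O(\<delta>)\<close>, which vanishes.

  Type II errors.  Choose \<open>t\<close> with \<open>2 exp (- t\<^sup>2 / 2) = \<alpha> \<delta> p\<close>.  As soon as at least \<open>\<delta> m p\<close>
  alternatives satisfy \<open>\<bar>X\<^sub>i\<bar> \<ge> t \<sigma>\<close>, the step-up rule rejects all of these; if there are fewer, accepting
  them costs less than \<open>\<delta>\<^sub>A \<delta> m p\<close>.  No concentration argument is needed, and the normalised cost is at
  most \<open>H (t / sqrt (1 + u)) + \<delta>\<close> (\<open>expectation_false_acceptances_BH_le\<close>).  Finally
  \<open>t\<^sup>2 = - 2 ln (\<alpha> \<delta> p / 2)\<close> and \<open>ln v\<close> are both asymptotic to \<open>2 \<beta> ln m\<close>, because \<open>ln \<delta>\<close> is of smaller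
  order than \<open>ln m\<close> and \<open>ln u\<close> of smaller order than \<open>ln v\<close>, so that \<open>t\<^sup>2 / (1 + u)\<close> tends to \<open>C\<close> as
  well (\<open>BH_threshold_limit\<close>).
\<close>

section \<open>The step-up rule as a counting fixed point\<close>

text \<open>
  The largest \<open>k \<le> m\<close> such that at least \<open>k\<close> of the values \<open>q\<^sub>1, \<dots>, q\<^sub>m\<close> are at most \<open>k a / m\<close>.
  For \<open>a \<ge> 0\<close> this is the number of hypotheses that the step-up rule at level \<open>a\<close> rejects, and
  the value is \<open>0\<close> if nothing is rejected.  The vector \<open>q\<close> is arbitrary, so that some of the
  p-values can be replaced by \<open>0\<close>.
\<close>

definition num_rejected :: "nat \<Rightarrow> real \<Rightarrow> (nat \<Rightarrow> real) \<Rightarrow> nat" where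
  "num_rejected m a q =
     Max {k \<in> {0..m}. k \<le> card {i \<in> {1..m}. q i \<le> real k * a / real m}}"

lemma num_rejected_in:
  "num_rejected m a q \<in> {k \<in> {0..m}. k \<le> card {i \<in> {1..m}. q i \<le> real k * a / real m}}"
  unfolding num_rejected_def by (rule Max_in) auto

lemma num_rejected_le: "num_rejected m a q \<le> m"
  using num_rejected_in[of m a q] by simp

lemma num_rejected_ge:
  assumes "k \<le> m" "k \<le> card {i \<in> {1..m}. q i \<le> real k * a / real m}"
  shows "k \<le> num_rejected m a q"
  unfolding num_rejected_def using assms by (intro Max_ge) auto

lemma card_num_rejected:
  assumes "a \<ge> 0"
  shows "card {i \<in> {1..m}. q i \<le> real (num_rejected m a q) * a / real m} = num_rejected m a q"
    (is "card ?R = ?r")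
proof (rule antisym)
  show "?r \<le> card ?R" using num_rejected_in[of m a q] by simp
  have "card ?R \<le> card {1..m}" by (intro card_mono) auto
  then have c: "card ?R \<le> m" by simp
  show "card ?R \<le> ?r"
  proof (rule num_rejected_ge[OF c])
    have "?r \<le> card ?R" by fact
    then have "real ?r * a / real m \<le> real (card ?R) * a / real m"
      using assms by (intro divide_right_mono mult_right_mono) auto
    then have "?R \<subseteq> {i \<in> {1..m}. q i \<le> real (card ?R) * a / real m}" by auto
    then show "card ?R \<le> card {i \<in> {1..m}. q i \<le> real (card ?R) * a / real m}"
      by (intro card_mono) auto
  qed
qed

lemma num_rejected_antimono:
  assumes "\<And>i. i \<in> {1..m} \<Longrightarrow> q i \<le> q' i"
  shows "num_rejected m a q' \<le> num_rejected m a q"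
proof (rule num_rejected_ge[OF num_rejected_le])
  let ?k = "num_rejected m a q'"
  have "?k \<le> card {i \<in> {1..m}. q' i \<le> real ?k * a / real m}"
    using num_rejected_in[of m a q'] by simp
  also have "\<dots> \<le> card {i \<in> {1..m}. q i \<le> real ?k * a / real m}"
    using assms by (intro card_mono) (auto intro: order_trans)
  finally show "?k \<le> card {i \<in> {1..m}. q i \<le> real ?k * a / real m}" .
qed

lemma nth_le_iff_length_filter:
  fixes xs :: "'a :: linorder list"
  assumes "sorted xs" "j < length xs"
  shows "xs ! j \<le> y \<longleftrightarrow> j < length (filter (\<lambda>x. x \<le> y) xs)"
  using assms
proof (induction xs arbitrary: j)
  case (Cons x xs)
  show ?case
  proof (cases "x \<le> y")
    case True
    then show ?thesis using Cons by (cases j) auto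
  next
    case False
    then have "filter (\<lambda>x. x \<le> y) (x # xs) = []"
      using Cons.prems by (auto simp: filter_empty_conv)
    moreover have "x \<le> (x # xs) ! j" using Cons.prems by (cases j) auto
    ultimately show ?thesis using False by auto
  qed
qed simp

lemma ordered_p_value_le_iff:
  assumes "j \<in> {1..m}"
  shows "ordered_p_value m \<sigma> x j \<le> y \<longleftrightarrow> j \<le> card {i \<in> {1..m}. p_value \<sigma> x i \<le> y}"
proof -
  let ?xs = "map (p_value \<sigma> x) [1..<Suc m]"
  have "length (filter (\<lambda>z. z \<le> y) (sort ?xs)) = length (filter (\<lambda>z. z \<le> y) ?xs)"
    by (simp only: filter_sort length_sort)
  also have "\<dots> = length (filter (\<lambda>i. p_value \<sigma> x i \<le> y) [1..<Suc m])"
    by (simp only: filter_map length_map o_def)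
  also have "\<dots> = card (set (filter (\<lambda>i. p_value \<sigma> x i \<le> y) [1..<Suc m]))"
    by (intro distinct_card[symmetric] distinct_filter distinct_upt)
  also have "set (filter (\<lambda>i. p_value \<sigma> x i \<le> y) [1..<Suc m]) = {i \<in> {1..m}. p_value \<sigma> x i \<le> y}"
    by (auto simp del: upt_Suc)
  finally have "length (filter (\<lambda>z. z \<le> y) (sort ?xs)) = card {i \<in> {1..m}. p_value \<sigma> x i \<le> y}" .
  moreover have "j - 1 < length (sort ?xs)" using assms by auto
  ultimately have "sort ?xs ! (j - 1) \<le> y \<longleftrightarrow> j - 1 < card {i \<in> {1..m}. p_value \<sigma> x i \<le> y}"
    using nth_le_iff_length_filter[of "sort ?xs" "j - 1" y] by simp
  then show ?thesis using assms unfolding ordered_p_value_def by auto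
qed

text \<open>
  The rejection threshold, an ordered p-value in the definition of the rule, may be replaced by
  the number of rejections times \<open>a / m\<close>.
\<close>

lemma mem_BH_rule_iff:
  assumes "a \<ge> 0"
  shows "i \<in> BH_rule m a \<sigma> x \<longleftrightarrow>
    i \<in> {1..m} \<and> p_value \<sigma> x i \<le> real (num_rejected m a (p_value \<sigma> x)) * a / real m"
proof -
  let ?q = "p_value \<sigma> x"
  let ?r = "num_rejected m a ?q"
  let ?R = "\<lambda>y. {i \<in> {1..m}. ?q i \<le> y}"
  let ?B = "BH_indices m a \<sigma> x"
  have B: "?B = {j \<in> {1..m}. j \<le> card (?R (real j * a / real m))}"
    unfolding BH_indices_def by (auto simp: ordered_p_value_le_iff)
  have fB: "finite ?B" unfolding B by auto
  have card_r: "card (?R (real ?r * a / real m)) = ?r" by (rule card_num_rejected[OF assms])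
  show ?thesis
  proof (cases "?r = 0")
    case True
    have "?B = {}"
    proof (rule ccontr)
      assume "?B \<noteq> {}"
      then obtain j where "j \<in> ?B" by auto
      then have "j \<le> ?r" "1 \<le> j" unfolding B by (auto intro!: num_rejected_ge)
      then show False using True by simp
    qed
    moreover have "?R (real ?r * a / real m) = {}"
    proof -
      have "finite (?R (real ?r * a / real m))" by simp
      then show ?thesis using card_r True by (metis card_0_eq)
    qed
    ultimately show ?thesis by (auto simp: BH_rule_def)
  next
    case False
    have r: "?r \<in> ?B" unfolding B using False num_rejected_le[of m a ?q] card_r by simp
    have "Max ?B = ?r"
      using r fB by (intro Max_eqI) (auto simp: B intro!: num_rejected_ge)
    moreover have "?q i \<le> ordered_p_value m \<sigma> x ?r \<longleftrightarrow> ?q i \<le> real ?r * a / real m"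
      if i: "i \<in> {1..m}"
    proof
      have rm: "?r \<in> {1..m}" using r unfolding B by simp
      have "ordered_p_value m \<sigma> x ?r \<le> real ?r * a / real m"
        using r by (simp add: BH_indices_def)
      then show "?q i \<le> real ?r * a / real m" if "?q i \<le> ordered_p_value m \<sigma> x ?r"
        using that by simp
      \<comment> \<open>Exactly \<open>r\<close> of the p-values are at most \<open>r a / m\<close>, and at least \<open>r\<close> are at most the
        \<open>r\<close>-th smallest one; hence the two thresholds select the same indices.\<close>
      have "?r \<le> card (?R (ordered_p_value m \<sigma> x ?r))"
        using ordered_p_value_le_iff[OF rm, of \<sigma> x "ordered_p_value m \<sigma> x ?r"] by simp
      moreover have sub: "?R (ordered_p_value m \<sigma> x ?r) \<subseteq> ?R (real ?r * a / real m)"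
        using \<open>ordered_p_value m \<sigma> x ?r \<le> _\<close> by auto
      ultimately have "?R (ordered_p_value m \<sigma> x ?r) = ?R (real ?r * a / real m)"
        using card_r by (intro card_seteq) auto
      then show "?q i \<le> ordered_p_value m \<sigma> x ?r" if "?q i \<le> real ?r * a / real m"
        using that i by blast
    qed
    ultimately show ?thesis using r by (auto simp: BH_rule_def)
  qed
qed

section \<open>The standard normal law and p-values\<close>

interpretation std_normal: real_distribution std_normal_distribution
  by (rule real_dist_normal_dist)

abbreviation normal_cdf :: "real \<Rightarrow> real" where
  "normal_cdf \<equiv> cdf std_normal_distribution"

lemma distr_std_normal_affine:
  assumes "s \<noteq> 0"
  shows "distr std_normal_distribution borel (\<lambda>x. b + s * x) = density lborel (normal_density b \<bar>s\<bar>)"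
proof -
  have "distributed std_normal_distribution lborel (\<lambda>x. x) std_normal_density"
    by (auto simp: distributed_def intro!: distr_id2)
  from std_normal.normal_density_affine[OF this, of s b] assms
  have "distributed std_normal_distribution lborel (\<lambda>x. b + s * x) (normal_density b \<bar>s\<bar>)"
    by simp
  then have "distr std_normal_distribution lborel (\<lambda>x. b + s * x) = density lborel (normal_density b \<bar>s\<bar>)"
    by (simp add: distributed_def)
  moreover have "distr std_normal_distribution lborel (\<lambda>x. b + s * x) = distr std_normal_distribution borel (\<lambda>x. b + s * x)"
    by (intro distr_cong) auto
  ultimately show ?thesis by simp
qed

lemma measure_normal_law:
  assumes "s > 0" "A \<in> sets borel"
  shows "measure (normal_law s) A = measure std_normal_distribution {x. s * x \<in> A}"
proof -
  have "normal_law s = distr std_normal_distribution borel (\<lambda>x. 0 + s * x)"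
    unfolding distr_std_normal_affine[OF less_imp_neq[OF assms(1), symmetric]]
    using assms by (simp add: normal_law_def)
  then show ?thesis using assms by (simp add: measure_distr vimage_def)
qed

lemma std_normal_singleton: "measure std_normal_distribution {x} = 0"
proof -
  have "emeasure std_normal_distribution {x} = 0"
    by (subst emeasure_density) (auto simp: nn_integral_0_iff_AE intro!: AE_I[where N = "{x}"] split: split_indicator)
  then show ?thesis by (simp add: measure_def)
qed

lemma isCont_normal_cdf: "isCont normal_cdf x"
  by (simp add: std_normal.isCont_cdf std_normal_singleton)

lemma borel_measurable_normal_cdf [measurable]: "normal_cdf \<in> borel_measurable borel"
  by (intro borel_measurable_continuous_onI continuous_at_imp_continuous_on ballI isCont_normal_cdf)

lemma std_normal_atLeast: "measure std_normal_distribution {x..} = 1 - normal_cdf x"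
proof -
  have "measure std_normal_distribution {x<..} = 1 - normal_cdf x"
    using std_normal.prob_compl[of "{..x}"] by (simp add: cdf_def Compl_eq_Diff_UNIV[symmetric])
  moreover have "measure std_normal_distribution {x..} =
      measure std_normal_distribution {x} + measure std_normal_distribution {x<..}"
    by (subst std_normal.finite_measure_Union[symmetric]) (auto intro!: arg_cong[where f = "measure _"])
  ultimately show ?thesis by (simp add: std_normal_singleton)
qed

lemma normal_cdf_uminus: "normal_cdf (- x) = 1 - normal_cdf x"
proof -
  have "distr std_normal_distribution borel (\<lambda>x. 0 + (- 1) * x) = std_normal_distribution"
    by (subst distr_std_normal_affine) auto
  then have "normal_cdf (- x) = measure (distr std_normal_distribution borel (\<lambda>x. 0 + (- 1) * x)) {..- x}"
    by (simp add: cdf_def)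
  also have "\<dots> = measure std_normal_distribution {x..}"
    by (subst measure_distr) (auto intro!: arg_cong[where f = "measure _"])
  finally show ?thesis by (simp add: std_normal_atLeast)
qed

lemma std_normal_two_sided_tail:
  assumes "t \<ge> 0"
  shows "measure std_normal_distribution {x. t \<le> \<bar>x\<bar>} = 2 * (1 - normal_cdf t)"
proof (cases "t = 0")
  case True
  have "normal_cdf 0 = 1 / 2" using normal_cdf_uminus[of 0] by simp
  moreover have "measure std_normal_distribution {x. t \<le> \<bar>x\<bar>} = 1"
    using True std_normal.prob_space by simp
  ultimately show ?thesis using True by simp
next
  case False
  have "{x. t \<le> \<bar>x\<bar>} = {..- t} \<union> {t..}" by auto
  then have "measure std_normal_distribution {x. t \<le> \<bar>x\<bar>} = normal_cdf (- t) + measure std_normal_distribution {t..}"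
    using False assms by (subst cdf_def, subst std_normal.finite_measure_Union[symmetric]) auto
  then show ?thesis by (simp add: normal_cdf_uminus std_normal_atLeast)
qed

text \<open>
  The tail beyond \<open>t\<close> is the mass that \<open>N(- t, 1)\<close> gives to the positive half-line, and there the
  density of \<open>N(- t, 1)\<close> is at most \<open>exp (- t\<^sup>2 / 2)\<close> times the density of \<open>N(0, 1)\<close>.
\<close>

lemma normal_tail_le:
  assumes "t \<ge> 0"
  shows "1 - normal_cdf t \<le> exp (- t\<^sup>2 / 2)"
proof -
  have "emeasure std_normal_distribution {t..} =
      emeasure (distr std_normal_distribution borel (\<lambda>x. - t + 1 * x)) {0..}"
    by (subst emeasure_distr) (auto intro!: arg_cong[where f = "emeasure _"])
  also have "\<dots> = (\<integral>\<^sup>+x. ennreal (normal_density (- t) 1 x) * indicator {0..} x \<partial>lborel)"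
    by (subst distr_std_normal_affine) (auto simp: emeasure_density)
  also have "\<dots> \<le> (\<integral>\<^sup>+x. ennreal (exp (- t\<^sup>2 / 2)) * ennreal (std_normal_density x) \<partial>lborel)"
  proof (intro nn_integral_mono)
    fix x :: real
    have "normal_density (- t) 1 x \<le> exp (- t\<^sup>2 / 2) * std_normal_density x" if "x \<ge> 0"
    proof -
      have "- (x + t)\<^sup>2 / 2 \<le> - t\<^sup>2 / 2 + - x\<^sup>2 / 2"
        using that assms by (simp add: power2_sum)
      then have "exp (- (x + t)\<^sup>2 / 2) \<le> exp (- t\<^sup>2 / 2) * exp (- x\<^sup>2 / 2)"
        unfolding exp_add[symmetric] exp_le_cancel_iff .
      then show ?thesis
        by (simp add: normal_density_def divide_right_mono)
    qed
    then show "ennreal (normal_density (- t) 1 x) * indicator {0..} x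
        \<le> ennreal (exp (- t\<^sup>2 / 2)) * ennreal (std_normal_density x)"
      by (auto simp: ennreal_mult[symmetric] split: split_indicator intro!: ennreal_leI)
  qed
  also have "\<dots> = ennreal (exp (- t\<^sup>2 / 2)) * emeasure std_normal_distribution UNIV"
    by (subst nn_integral_cmult) (auto simp: emeasure_density)
  also have "\<dots> = ennreal (exp (- t\<^sup>2 / 2))"
    using std_normal.emeasure_space_1 by simp
  finally show ?thesis
    unfolding std_normal_atLeast[symmetric] by (simp add: std_normal.emeasure_eq_measure)
qed

text \<open>
  The probability that a standard normal variable is smaller than \<open>a\<close> in absolute value.
\<close>

definition central_mass :: "real \<Rightarrow> real" where
  "central_mass a = measure std_normal_distribution {x. \<bar>x\<bar> < a}"

lemma central_mass_eq:
  assumes "a \<ge> 0"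
  shows "central_mass a = 2 * normal_cdf a - 1"
proof -
  have "{x. \<bar>x\<bar> < a} = UNIV - {x. a \<le> \<bar>x\<bar>}" by auto
  then have "central_mass a = 1 - measure std_normal_distribution {x. a \<le> \<bar>x\<bar>}"
    unfolding central_mass_def using std_normal.prob_compl[of "{x. a \<le> \<bar>x\<bar>}"] by simp
  then show ?thesis by (simp add: std_normal_two_sided_tail[OF assms])
qed

lemma central_mass_pos:
  assumes "a > 0"
  shows "central_mass a > 0"
proof (rule ccontr)
  assume "\<not> central_mass a > 0"
  then have "emeasure std_normal_distribution {x. \<bar>x\<bar> < a} = 0"
    using measure_nonneg[of std_normal_distribution "{x. \<bar>x\<bar> < a}"]
    by (simp add: central_mass_def std_normal.emeasure_eq_measure)
  moreover have "std_normal_density x \<noteq> 0" for x :: real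
    using normal_density_pos[of 1 0 x] by simp
  ultimately have "AE x in lborel. x \<notin> {x. \<bar>x\<bar> < a}"
    by (subst (asm) emeasure_density)
       (auto simp: nn_integral_0_iff_AE split: split_indicator_asm elim!: eventually_mono)
  then have "emeasure lborel {x. \<bar>x\<bar> < a} = 0"
    using AE_iff_measurable[of "{x. \<bar>x\<bar> < a}" lborel "\<lambda>x. x \<notin> {x. \<bar>x\<bar> < a}"] by simp
  moreover have "{x. \<bar>x\<bar> < a} = {- a<..<a}" by auto
  ultimately show False using assms by simp
qed

lemma tendsto_central_mass:
  assumes "(f \<longlongrightarrow> a) F" "a > 0"
  shows "((\<lambda>x. central_mass (f x)) \<longlongrightarrow> central_mass a) F"
proof -
  have "((\<lambda>x. 2 * normal_cdf (f x) - 1) \<longlongrightarrow> 2 * normal_cdf a - 1) F"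
    by (intro tendsto_intros isCont_tendsto_compose[OF isCont_normal_cdf] assms)
  moreover have "\<forall>\<^sub>F x in F. 2 * normal_cdf (f x) - 1 = central_mass (f x)"
    using order_tendstoD(1)[OF assms] by eventually_elim (simp add: central_mass_eq)
  ultimately show ?thesis
    using assms by (simp add: central_mass_eq filterlim_cong[OF refl refl])
qed

lemma measure_normal_law_central:
  assumes "s > 0"
  shows "measure (normal_law s) {x. \<bar>x\<bar> < a} = central_mass (a / s)"
proof -
  have "{x. \<bar>s * x\<bar> < a} = {x. \<bar>x\<bar> < a / s}"
    using assms by (auto simp: abs_mult field_simps)
  then show ?thesis using assms by (simp add: measure_normal_law central_mass_def)
qed

lemma p_value_nonneg: "0 \<le> p_value \<sigma> x i"
  using std_normal.cdf_bounded_prob by (simp add: p_value_def)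

lemma p_value_le:
  assumes "\<sigma> > 0" "t \<ge> 0" "t * \<sigma> \<le> \<bar>x i\<bar>"
  shows "p_value \<sigma> x i \<le> 2 * exp (- t\<^sup>2 / 2)"
proof -
  have "t \<le> \<bar>x i\<bar> / \<sigma>" using assms by (simp add: field_simps)
  then have "p_value \<sigma> x i \<le> 2 * (1 - normal_cdf t)"
    using std_normal.cdf_nondecreasing[of t "\<bar>x i\<bar> / \<sigma>"] by (simp add: p_value_def)
  also have "\<dots> \<le> 2 * exp (- t\<^sup>2 / 2)" using normal_tail_le[OF assms(2)] by simp
  finally show ?thesis .
qed

text \<open>
  Under the null law the p-value is stochastically at least uniform.
\<close>

lemma p_value_superuniform:
  assumes "\<sigma> > 0" "y \<ge> 0"
  shows "measure (normal_law \<sigma>) {x. 2 * (1 - normal_cdf (\<bar>x\<bar> / \<sigma>)) \<le> y} \<le> y"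
proof -
  let ?G = "\<lambda>t. 2 * (1 - normal_cdf t)"
  define S where "S = {t. t \<ge> 0 \<and> ?G t \<le> y}"
  have "measure (normal_law \<sigma>) {x. ?G (\<bar>x\<bar> / \<sigma>) \<le> y} = measure std_normal_distribution {x. \<bar>x\<bar> \<in> S}"
    using assms by (subst measure_normal_law) (auto simp: abs_mult S_def)
  also have "\<dots> \<le> y"
  proof (cases "S = {}")
    case True
    then show ?thesis using assms by simp
  next
    case False
    \<comment> \<open>\<open>S\<close> is closed, so its infimum is a cut-off at which the tail is still at most \<open>y\<close>.\<close>
    have bb: "bdd_below S" by (auto simp: S_def bdd_below_def)
    have "closed S"
      unfolding S_def by (intro closed_Collect_conj closed_Collect_le continuous_intros
        continuous_at_imp_continuous_on ballI isCont_normal_cdf)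
    then have I: "Inf S \<in> S" using False bb by (intro closed_contains_Inf)
    have "measure std_normal_distribution {x. \<bar>x\<bar> \<in> S} \<le> measure std_normal_distribution {x. Inf S \<le> \<bar>x\<bar>}"
      using bb by (intro std_normal.finite_measure_mono) (auto intro: cInf_lower)
    also have "\<dots> = ?G (Inf S)" using I by (intro std_normal_two_sided_tail) (simp add: S_def)
    also have "\<dots> \<le> y" using I by (simp add: S_def)
    finally show ?thesis .
  qed
  finally show ?thesis .
qed

section \<open>Measurability of the step-up rule\<close>

lemma num_rejected_cong:
  assumes "\<And>i. i \<in> {1..m} \<Longrightarrow> q i = q' i"
  shows "num_rejected m a q = num_rejected m a q'"
  using assms by (intro antisym num_rejected_antimono) auto

lemma measurable_num_rejected:
  assumes "\<And>i. i \<in> {1..m} \<Longrightarrow> (\<lambda>\<omega>. q \<omega> i) \<in> borel_measurable M"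
  shows "(\<lambda>\<omega>. num_rejected m a (q \<omega>)) \<in> M \<rightarrow>\<^sub>M count_space UNIV"
proof -
  have [measurable]: "Measurable.pred M (\<lambda>\<omega>. i \<in> {1..m} \<and> q \<omega> i \<le> y)" for i y
    using assms[of i] by (cases "i \<in> {1..m}") auto
  have "(\<lambda>\<omega>. card {i \<in> {1..m}. q \<omega> i \<le> y}) \<in> M \<rightarrow>\<^sub>M count_space UNIV" for y
    by (rule measurable_card) measurable
  note [measurable] = this
  show ?thesis unfolding num_rejected_def by measurable
qed

lemma measurable_p_value:
  assumes "(\<lambda>\<omega>. x \<omega> i) \<in> borel_measurable M"
  shows "(\<lambda>\<omega>. p_value \<sigma> (x \<omega>) i) \<in> borel_measurable M"
  using assms unfolding p_value_def by measurable

lemma measurable_rule_BH: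
  assumes "a \<ge> 0"
  shows "measurable_rule m (BH_rule m a \<sigma>)"
  unfolding measurable_rule_def
proof
  fix i assume i: "i \<in> {1..m}"
  let ?P = "\<Pi>\<^sub>M i\<in>{1..m}. (borel :: real measure)"
  have p: "(\<lambda>x. p_value \<sigma> x j) \<in> borel_measurable ?P" if "j \<in> {1..m}" for j
    by (rule measurable_p_value) (use that in measurable)
  note [measurable] = p[OF i]
  have [measurable]: "(\<lambda>x. num_rejected m a (p_value \<sigma> x)) \<in> ?P \<rightarrow>\<^sub>M count_space UNIV"
    by (rule measurable_num_rejected) (rule p)
  have "{x \<in> space ?P. i \<in> BH_rule m a \<sigma> x} =
     {x \<in> space ?P. p_value \<sigma> x i \<le> real (num_rejected m a (p_value \<sigma> x)) * a / real m}"
    using i by (simp only: mem_BH_rule_iff[OF assms] simp_thms)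
  also have "\<dots> \<in> sets ?P" by measurable
  finally show "{x \<in> space ?P. i \<in> BH_rule m a \<sigma> x} \<in> sets ?P" .
qed

section \<open>The two-groups model\<close>

lemma (in prob_space)
  assumes I: "finite I" and Q: "\<And>i. i \<in> I \<Longrightarrow> {\<omega> \<in> space M. Q i \<omega>} \<in> events"
  shows integrable_card: "integrable M (\<lambda>\<omega>. real (card {i \<in> I. Q i \<omega>}))"
    and expectation_card: "expectation (\<lambda>\<omega>. real (card {i \<in> I. Q i \<omega>})) =
      (\<Sum>i\<in>I. prob {\<omega> \<in> space M. Q i \<omega>})"
proof -
  let ?A = "\<lambda>i. {\<omega> \<in> space M. Q i \<omega>}"
  have int: "integrable M (indicat_real (?A i))" if "i \<in> I" for i
    using Q[OF that] by (simp add: less_top[symmetric])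
  have eq: "real (card {i \<in> I. Q i \<omega>}) = (\<Sum>i\<in>I. indicat_real (?A i) \<omega>)" if "\<omega> \<in> space M" for \<omega>
  proof -
    have "(\<Sum>i\<in>I. indicat_real (?A i) \<omega>) = (\<Sum>i\<in>I. if Q i \<omega> then 1 else 0)"
      using that by (intro sum.cong) (auto simp: indicator_def)
    then show ?thesis using I by (simp add: sum.inter_filter[symmetric])
  qed
  have "integrable M (\<lambda>\<omega>. \<Sum>i\<in>I. indicat_real (?A i) \<omega>)" using int by auto
  then show "integrable M (\<lambda>\<omega>. real (card {i \<in> I. Q i \<omega>}))"
    using eq by (simp cong: Bochner_Integration.integrable_cong)
  have "expectation (\<lambda>\<omega>. real (card {i \<in> I. Q i \<omega>})) = expectation (\<lambda>\<omega>. \<Sum>i\<in>I. indicat_real (?A i) \<omega>)"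
    using eq by (intro Bochner_Integration.integral_cong) auto
  also have "\<dots> = (\<Sum>i\<in>I. prob (?A i))"
    using int Q by (subst Bochner_Integration.integral_sum) auto
  finally show "expectation (\<lambda>\<omega>. real (card {i \<in> I. Q i \<omega>})) = (\<Sum>i\<in>I. prob (?A i))" .
qed

text \<open>
  The mixture model for one fixed number of tests, with admissible parameters.
\<close>

locale two_groups = prob_space M for M :: "'a measure" +
  fixes m :: nat and \<nu> :: "nat \<Rightarrow> 'a \<Rightarrow> bool" and X :: "nat \<Rightarrow> 'a \<Rightarrow> real" and p \<sigma> \<tau> :: real
  assumes p: "0 < p" "p < 1" and pos: "\<sigma> > 0" "\<tau> > 0" and m: "m \<ge> 1"
    and model: "mixture_model m M \<nu> X p \<sigma> \<tau>"
begin

lemma indep: "indep_vars (\<lambda>_. count_space UNIV \<Otimes>\<^sub>M borel) (\<lambda>i \<omega>. (\<nu> i \<omega>, X i \<omega>)) {1..m}"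
  using model by (simp add: mixture_model_def)

lemma measurable_pair: "i \<in> {1..m} \<Longrightarrow> (\<lambda>\<omega>. (\<nu> i \<omega>, X i \<omega>)) \<in> M \<rightarrow>\<^sub>M count_space UNIV \<Otimes>\<^sub>M borel"
  using indep by (auto simp: indep_vars_def)

lemma measurable_nu: "i \<in> {1..m} \<Longrightarrow> Measurable.pred M (\<nu> i)"
  using measurable_compose[OF measurable_pair measurable_fst] by simp

lemma measurable_X: "i \<in> {1..m} \<Longrightarrow> X i \<in> borel_measurable M"
  using measurable_compose[OF measurable_pair measurable_snd] by simp

lemma prob_nu: "i \<in> {1..m} \<Longrightarrow> prob {\<omega> \<in> space M. \<nu> i \<omega>} = p"
  using model by (simp add: mixture_model_def)

lemma prob_null_and_alternative:
  assumes i: "i \<in> {1..m}" and A: "A \<in> sets borel"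
  shows prob_null: "prob {\<omega> \<in> space M. \<not> \<nu> i \<omega> \<and> X i \<omega> \<in> A} = (1 - p) * measure (normal_law \<sigma>) A"
    and prob_alternative: "prob {\<omega> \<in> space M. \<nu> i \<omega> \<and> X i \<omega> \<in> A} =
      p * measure (normal_law (sqrt (\<sigma>\<^sup>2 + \<tau>\<^sup>2))) A"
proof -
  note [measurable] = measurable_nu[OF i] measurable_X[OF i] A
  have *: "prob {\<omega> \<in> space M. \<omega> \<in> B \<and> X i \<omega> \<in> A} = prob B * measure (normal_law s) A"
    if [measurable]: "B \<in> events" and B: "prob B > 0"
      and law: "distr (uniform_measure M B) borel (X i) = normal_law s" for B s
  proof -
    have "measure (normal_law s) A = measure (uniform_measure M B) (X i -` A \<inter> space M)"
      unfolding law[symmetric] by (subst measure_distr) auto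
    also have "\<dots> = prob (B \<inter> (X i -` A \<inter> space M)) / prob B"
      using B by (subst measure_uniform_measure) (auto simp: emeasure_eq_measure)
    also have "B \<inter> (X i -` A \<inter> space M) = {\<omega> \<in> space M. \<omega> \<in> B \<and> X i \<omega> \<in> A}" by auto
    finally show ?thesis using B by simp
  qed
  have B1: "{\<omega> \<in> space M. \<nu> i \<omega>} \<in> events" and B0: "{\<omega> \<in> space M. \<not> \<nu> i \<omega>} \<in> events"
    by measurable
  have p0: "prob {\<omega> \<in> space M. \<not> \<nu> i \<omega>} = 1 - p"
    using prob_neg[OF B1] prob_nu[OF i] by simp
  show "prob {\<omega> \<in> space M. \<not> \<nu> i \<omega> \<and> X i \<omega> \<in> A} = (1 - p) * measure (normal_law \<sigma>) A"
    using *[OF B0, of \<sigma>] p p0 model i by (simp add: mixture_model_def conj_ac cong: conj_cong)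
  show "prob {\<omega> \<in> space M. \<nu> i \<omega> \<and> X i \<omega> \<in> A} = p * measure (normal_law (sqrt (\<sigma>\<^sup>2 + \<tau>\<^sup>2))) A"
    using *[OF B1, of "sqrt (\<sigma>\<^sup>2 + \<tau>\<^sup>2)"] p prob_nu[OF i] model i
    by (simp add: mixture_model_def conj_ac cong: conj_cong)
qed

section \<open>The expected number of rejections\<close>

text \<open>
  The number of rejections after the p-values with index in \<open>A\<close> have been replaced by \<open>0\<close>.  It
  does not depend on the observations with index in \<open>A\<close>.
\<close>

definition rejections_zeroing :: "real \<Rightarrow> nat set \<Rightarrow> 'a \<Rightarrow> nat" where
  "rejections_zeroing a A \<omega> =
     num_rejected m a (\<lambda>i. if i \<in> A then 0 else p_value \<sigma> (\<lambda>j. X j \<omega>) i)"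

lemma measurable_pv: "i \<in> {1..m} \<Longrightarrow> (\<lambda>\<omega>. p_value \<sigma> (\<lambda>j. X j \<omega>) i) \<in> borel_measurable M"
  by (intro measurable_p_value measurable_X)

lemma measurable_rejections_zeroing [measurable]:
  "rejections_zeroing a A \<in> M \<rightarrow>\<^sub>M count_space UNIV"
proof -
  have "(\<lambda>\<omega>. if i \<in> A then 0 else p_value \<sigma> (\<lambda>j. X j \<omega>) i) \<in> borel_measurable M" if "i \<in> {1..m}" for i
    using measurable_pv[OF that] by (cases "i \<in> A") auto
  then show ?thesis
    unfolding rejections_zeroing_def[abs_def] by (rule measurable_num_rejected)
qed

lemma rejections_zeroing_le: "rejections_zeroing a A \<omega> \<le> m"
  unfolding rejections_zeroing_def by (rule num_rejected_le)

lemma integrable_rejections_zeroing: "integrable M (\<lambda>\<omega>. real (rejections_zeroing a A \<omega>))"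
  by (rule integrable_const_bound[where B = "real m"]) (auto simp: rejections_zeroing_le)

lemma rejections_zeroing_mono:
  assumes "A \<subseteq> B"
  shows "rejections_zeroing a A \<omega> \<le> rejections_zeroing a B \<omega>"
  unfolding rejections_zeroing_def using assms by (intro num_rejected_antimono) (auto simp: p_value_nonneg)

lemma indep_rejections_zeroing:
  assumes i: "i \<in> {1..m}" "i \<in> A" and S: "S \<in> sets (count_space UNIV \<Otimes>\<^sub>M borel)"
  shows "prob {\<omega> \<in> space M. (\<nu> i \<omega>, X i \<omega>) \<in> S \<and> rejections_zeroing a A \<omega> = r} =
    prob {\<omega> \<in> space M. (\<nu> i \<omega>, X i \<omega>) \<in> S} * prob {\<omega> \<in> space M. rejections_zeroing a A \<omega> = r}"
proof -
  let ?J = "{1..m} - {i}"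
  let ?N = "count_space UNIV \<Otimes>\<^sub>M borel :: (bool \<times> real) measure"
  let ?W = "\<lambda>i \<omega>. (\<nu> i \<omega>, X i \<omega>)"
  define g where "g = (\<lambda>h. num_rejected m a (\<lambda>j. if j \<in> A then 0 else p_value \<sigma> (\<lambda>k. snd (h k :: bool \<times> real)) j))" 
  have g: "g \<in> PiM ?J (\<lambda>_. ?N) \<rightarrow>\<^sub>M count_space UNIV"
    unfolding g_def
  proof (rule measurable_num_rejected)
    fix j assume j: "j \<in> {1..m}"
    show "(\<lambda>h. if j \<in> A then 0 else p_value \<sigma> (\<lambda>k. snd (h k)) j) \<in> borel_measurable (PiM ?J (\<lambda>_. ?N))"
    proof (cases "j \<in> A")
      case False
      then have "j \<in> ?J" using j assms by auto
      then have "(\<lambda>h. snd (h j)) \<in> borel_measurable (PiM ?J (\<lambda>_. ?N))"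
        by (rule measurable_compose[OF measurable_component_singleton[of j ?J "\<lambda>_. ?N"] measurable_snd])
      then show ?thesis using False by (simp add: measurable_p_value)
    qed simp
  qed
  let ?Wi = "\<lambda>\<omega>. restrict (\<lambda>i. ?W i \<omega>) {i}"
  let ?WJ = "\<lambda>\<omega>. restrict (\<lambda>i. ?W i \<omega>) ?J"
  let ?Si = "(\<lambda>h. h i) -` S \<inter> space (PiM {i} (\<lambda>_. ?N))"
  let ?SJ = "g -` {r} \<inter> space (PiM ?J (\<lambda>_. ?N))"
  have ind: "indep_var (PiM {i} (\<lambda>_. ?N)) ?Wi (PiM ?J (\<lambda>_. ?N)) ?WJ"
    using i by (intro indep_var_restrict[OF indep]) auto
  have Si: "?Si \<in> sets (PiM {i} (\<lambda>_. ?N))"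
    by (rule measurable_sets[OF measurable_component_singleton[of i "{i}" "\<lambda>_. ?N"] S]) simp
  have SJ: "?SJ \<in> sets (PiM ?J (\<lambda>_. ?N))"
    by (rule measurable_sets[OF g]) simp
  have gW: "g (?WJ \<omega>) = rejections_zeroing a A \<omega>" for \<omega>
    using i by (auto simp: g_def rejections_zeroing_def p_value_def intro!: num_rejected_cong)
  have WJ_space: "?WJ \<omega> \<in> space (PiM ?J (\<lambda>_. ?N))" for \<omega>
    by (auto simp: space_PiM space_pair_measure)
  have "?Wi -` ?Si \<inter> space M = {\<omega> \<in> space M. (\<nu> i \<omega>, X i \<omega>) \<in> S}"
    by (auto simp: space_PiM space_pair_measure)
  moreover have "?WJ -` ?SJ \<inter> space M = {\<omega> \<in> space M. rejections_zeroing a A \<omega> = r}"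
    by (simp add: vimage_def Int_def gW WJ_space conj_commute cong: conj_cong del: restrict_apply One_nat_def)
  moreover have "(\<lambda>\<omega>. (?Wi \<omega>, ?WJ \<omega>)) -` (?Si \<times> ?SJ) \<inter> space M =
      (?Wi -` ?Si \<inter> space M) \<inter> (?WJ -` ?SJ \<inter> space M)" by blast
  ultimately show ?thesis
    using indep_varD[OF ind Si SJ] by (simp add: Collect_conj_eq[symmetric] conj_ac)
qed

text \<open>
  Conditionally on the number of rejections \<open>r\<close>, which is independent of \<open>(\<nu>\<^sub>i, X\<^sub>i)\<close> because
  \<open>i \<in> A\<close>, the event has probability at most \<open>r a / m\<close>.
\<close>

lemma prob_null_rejected_le:
  assumes i: "i \<in> {1..m}" "i \<in> A" and a: "a \<ge> 0"
  shows "prob {\<omega> \<in> space M. \<not> \<nu> i \<omega> \<and>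
      p_value \<sigma> (\<lambda>j. X j \<omega>) i \<le> real (rejections_zeroing a A \<omega>) * a / real m}
    \<le> a / real m * expectation (\<lambda>\<omega>. real (rejections_zeroing a A \<omega>))"
proof -
  let ?R = "rejections_zeroing a A"
  let ?pv = "\<lambda>\<omega>. p_value \<sigma> (\<lambda>j. X j \<omega>) i"
  let ?N = "count_space UNIV \<Otimes>\<^sub>M borel :: (bool \<times> real) measure"
  note [measurable] = measurable_nu[OF i(1)] measurable_pv[OF i(1)] measurable_X[OF i(1)]
  let ?E = "\<lambda>r. {\<omega> \<in> space M. \<not> \<nu> i \<omega> \<and> ?pv \<omega> \<le> real r * a / real m}"
  let ?F = "\<lambda>r. {\<omega> \<in> space M. ?R \<omega> = r}"
  have prod: "prob (?E r \<inter> ?F r) = prob (?E r) * prob (?F r)" for r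
  proof -
    let ?S = "{w \<in> space ?N. \<not> fst w \<and> 2 * (1 - normal_cdf (\<bar>snd w\<bar> / \<sigma>)) \<le> real r * a / real m}"
    have "?S \<in> sets ?N" by measurable
    moreover have "?E r = {\<omega> \<in> space M. (\<nu> i \<omega>, X i \<omega>) \<in> ?S}"
      by (auto simp: p_value_def space_pair_measure)
    moreover have "?E r \<inter> ?F r = {\<omega> \<in> space M. (\<nu> i \<omega>, X i \<omega>) \<in> ?S \<and> ?R \<omega> = r}"
      by (auto simp: p_value_def space_pair_measure)
    ultimately show ?thesis using indep_rejections_zeroing[OF i, of ?S a r] by simp
  qed
  have le: "prob (?E r) \<le> real r * a / real m" for r
  proof -
    let ?S = "{x. 2 * (1 - normal_cdf (\<bar>x\<bar> / \<sigma>)) \<le> real r * a / real m}"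
    have "?S \<in> sets borel" by measurable
    from prob_null[OF i(1) this]
    have "prob (?E r) = (1 - p) * measure (normal_law \<sigma>) ?S" by (simp add: p_value_def)
    also have "\<dots> \<le> 1 * measure (normal_law \<sigma>) ?S" using p by (intro mult_right_mono) auto
    also have "\<dots> \<le> real r * a / real m" using p_value_superuniform[OF pos(1), of "real r * a / real m"] a by simp
    finally show ?thesis .
  qed
  have "prob {\<omega> \<in> space M. \<not> \<nu> i \<omega> \<and> ?pv \<omega> \<le> real (?R \<omega>) * a / real m} = prob (\<Union>r\<in>{0..m}. ?E r \<inter> ?F r)"
    using rejections_zeroing_le by (intro arg_cong[where f = prob]) auto
  also have "\<dots> \<le> (\<Sum>r\<in>{0..m}. prob (?E r \<inter> ?F r))"
    by (intro finite_measure_subadditive_finite) auto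
  also have "\<dots> \<le> (\<Sum>r\<in>{0..m}. real r * a / real m * prob (?F r))"
    unfolding prod by (intro sum_mono mult_right_mono le) auto
  also have "\<dots> = a / real m * (\<Sum>r\<in>{0..m}. real r * prob (?F r))"
    by (simp add: sum_distrib_left mult_ac)
  also have "(\<Sum>r\<in>{0..m}. real r * prob (?F r)) = expectation (\<lambda>\<omega>. \<Sum>r\<in>{0..m}. real r * indicat_real (?F r) \<omega>)"
    by (subst Bochner_Integration.integral_sum) (auto simp: less_top[symmetric])
  also have "\<dots> = expectation (\<lambda>\<omega>. real (?R \<omega>))"
  proof (intro Bochner_Integration.integral_cong refl)
    fix \<omega> assume "\<omega> \<in> space M"
    then have "(\<Sum>r\<in>{0..m}. real r * indicat_real (?F r) \<omega>) = (\<Sum>r\<in>{0..m}. if r = ?R \<omega> then real r else 0)"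
      by (intro sum.cong) (auto simp: indicator_def)
    then show "(\<Sum>r\<in>{0..m}. real r * indicat_real (?F r) \<omega>) = real (?R \<omega>)"
      using rejections_zeroing_le[of a A \<omega>] by simp
  qed
  finally show ?thesis .
qed

text \<open>
  A rejected index lies in \<open>A\<close>, or is an alternative, or is a true null \<open>i \<notin> A\<close>.  Zeroing the
  p-value of such an \<open>i\<close> can only increase the number of rejections, so that the third kind is
  covered by \<open>prob_null_rejected_le\<close> for \<open>insert i A\<close>.
\<close>

lemma expectation_rejections_zeroing_step:
  assumes A: "A \<subseteq> {1..m}" and a: "a \<ge> 0" and B: "B \<ge> 0"
    and le: "\<And>i. i \<in> {1..m} - A \<Longrightarrow> expectation (\<lambda>\<omega>. real (rejections_zeroing a (insert i A) \<omega>)) \<le> B"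
  shows "expectation (\<lambda>\<omega>. real (rejections_zeroing a A \<omega>)) \<le> real (card A) + real m * p + a * B"
proof -
  let ?pv = "\<lambda>\<omega>. p_value \<sigma> (\<lambda>j. X j \<omega>)"
  let ?Q = "\<lambda>i \<omega>. \<not> \<nu> i \<omega> \<and> ?pv \<omega> i \<le> real (rejections_zeroing a (insert i A) \<omega>) * a / real m"
  have fA: "finite A" using A finite_subset by blast
  have ev1: "{\<omega> \<in> space M. \<nu> i \<omega>} \<in> events" if "i \<in> {1..m}" for i
    using measurable_nu[OF that] by measurable
  have ev2: "{\<omega> \<in> space M. ?Q i \<omega>} \<in> events" if "i \<in> {1..m} - A" for i
  proof -
    have "i \<in> {1..m}" using that by simp
    note [measurable] = measurable_nu[OF this] measurable_pv[OF this]
    show ?thesis by measurable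
  qed
  have fI: "finite {1..m}" "finite ({1..m} - A)" by auto
  note int1 = integrable_card[OF fI(1), of "\<lambda>i \<omega>. \<nu> i \<omega>", OF ev1]
    and e1 = expectation_card[OF fI(1), of "\<lambda>i \<omega>. \<nu> i \<omega>", OF ev1]
    and int2 = integrable_card[OF fI(2), of ?Q, OF ev2]
    and e2 = expectation_card[OF fI(2), of ?Q, OF ev2]
  have pw: "real (rejections_zeroing a A \<omega>) \<le>
      real (card A) + real (card {i \<in> {1..m}. \<nu> i \<omega>}) + real (card {i \<in> {1..m} - A. ?Q i \<omega>})" for \<omega>
  proof -
    let ?q = "\<lambda>i. if i \<in> A then 0 else ?pv \<omega> i"
    let ?T = "{i \<in> {1..m}. ?q i \<le> real (rejections_zeroing a A \<omega>) * a / real m}"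
    have "?T \<subseteq> A \<union> {i \<in> {1..m}. \<nu> i \<omega>} \<union> {i \<in> {1..m} - A. ?Q i \<omega>}"
    proof
      fix i assume i: "i \<in> ?T"
      have "real (rejections_zeroing a A \<omega>) * a / real m \<le> real (rejections_zeroing a (insert i A) \<omega>) * a / real m"
        using a rejections_zeroing_mono[of A "insert i A" a \<omega>] by (intro divide_right_mono mult_right_mono) auto
      then show "i \<in> A \<union> {i \<in> {1..m}. \<nu> i \<omega>} \<union> {i \<in> {1..m} - A. ?Q i \<omega>}"
        using i by (auto split: if_splits)
    qed
    then have "card ?T \<le> card (A \<union> {i \<in> {1..m}. \<nu> i \<omega>} \<union> {i \<in> {1..m} - A. ?Q i \<omega>})"
      using fA by (intro card_mono) auto
    also have "\<dots> \<le> card A + card {i \<in> {1..m}. \<nu> i \<omega>} + card {i \<in> {1..m} - A. ?Q i \<omega>}"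
      by (meson card_Un_le order_trans add_right_mono)
    also have "card ?T = rejections_zeroing a A \<omega>"
      unfolding rejections_zeroing_def by (rule card_num_rejected[OF a])
    finally show ?thesis by linarith
  qed
  have "expectation (\<lambda>\<omega>. real (rejections_zeroing a A \<omega>)) \<le>
      expectation (\<lambda>\<omega>. real (card A) + real (card {i \<in> {1..m}. \<nu> i \<omega>}) + real (card {i \<in> {1..m} - A. ?Q i \<omega>}))"
    by (intro integral_mono integrable_rejections_zeroing Bochner_Integration.integrable_add int1 int2 pw
        integrable_const)
  also have "\<dots> = real (card A) + (\<Sum>i\<in>{1..m}. prob {\<omega> \<in> space M. \<nu> i \<omega>}) +
      (\<Sum>i\<in>{1..m} - A. prob {\<omega> \<in> space M. ?Q i \<omega>})"
    using int1 int2 e1 e2 by (simp add: prob_space)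
  also have "\<dots> \<le> real (card A) + real m * p + (\<Sum>i\<in>{1..m} - A. a / real m * B)"
  proof (intro add_mono order_refl sum_mono)
    show "(\<Sum>i\<in>{1..m}. prob {\<omega> \<in> space M. \<nu> i \<omega>}) \<le> real m * p" by (simp add: prob_nu)
    fix i assume i: "i \<in> {1..m} - A"
    have "prob {\<omega> \<in> space M. ?Q i \<omega>} \<le> a / real m * expectation (\<lambda>\<omega>. real (rejections_zeroing a (insert i A) \<omega>))"
      using i a by (intro prob_null_rejected_le) auto
    also have "\<dots> \<le> a / real m * B" using a le[OF i] by (intro mult_left_mono) auto
    finally show "prob {\<omega> \<in> space M. ?Q i \<omega>} \<le> a / real m * B" .
  qed
  also have "(\<Sum>i\<in>{1..m} - A. a / real m * B) \<le> (\<Sum>i\<in>{1..m}. a / real m * B)"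
    using a B by (intro sum_mono2) auto
  also have "\<dots> = a * B" using m by simp
  finally show ?thesis by simp
qed

text \<open>
  The bound is the fixed point \<open>b\<^sub>k = (k + m p) / (1 - a) + a / (1 - a)\<^sup>2\<close> of the recursion
  \<open>b\<^sub>k = k + m p + a b\<^bsub>k+1\<^esub>\<close>.  The induction is downward, from \<open>A = {1..m}\<close>.
\<close>

lemma expectation_rejections_zeroing_le:
  assumes A: "A \<subseteq> {1..m}" and a: "0 \<le> a" "a < 1"
  shows "expectation (\<lambda>\<omega>. real (rejections_zeroing a A \<omega>)) \<le>
    (real (card A) + real m * p) / (1 - a) + a / (1 - a)\<^sup>2"
  using A
proof (induction "card ({1..m} - A)" arbitrary: A rule: less_induct)
  case less
  define B where "B = (real (card A) + 1 + real m * p) / (1 - a) + a / (1 - a)\<^sup>2"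
  have fA: "finite A" using less.prems finite_subset by blast
  have "B \<ge> 0" unfolding B_def using a p by simp
  moreover have "expectation (\<lambda>\<omega>. real (rejections_zeroing a (insert i A) \<omega>)) \<le> B"
    if i: "i \<in> {1..m} - A" for i
  proof -
    have "card ({1..m} - insert i A) < card ({1..m} - A)"
      using i by (intro psubset_card_mono finite_Diff finite_atLeastAtMost) blast
    moreover have "insert i A \<subseteq> {1..m}" using i less.prems by blast
    moreover have "real (card (insert i A)) = real (card A) + 1" using i fA by simp
    ultimately show ?thesis using less.hyps[of "insert i A"] unfolding B_def by metis
  qed
  ultimately have "expectation (\<lambda>\<omega>. real (rejections_zeroing a A \<omega>)) \<le> real (card A) + real m * p + a * B"
    using less.prems a by (intro expectation_rejections_zeroing_step) auto
  also have "\<dots> = (real (card A) + real m * p) / (1 - a) + a / (1 - a)\<^sup>2"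
  proof -
    have "c + x * ((c + 1) / b + x / b\<^sup>2) = c / b + x / b\<^sup>2" if "b > 0" "x = 1 - b" for c b x :: real
      using that(1) unfolding that(2) by (simp add: power2_eq_square field_simps)
    from this[of "1 - a" a "real (card A) + real m * p"] show ?thesis using a by (simp add: B_def add_ac)
  qed
  finally show ?case .
qed

section \<open>Finite-sample risk bounds\<close>

lemma mem_BH_rule_observations:
  assumes "a \<ge> 0"
  shows "i \<in> BH_rule m a \<sigma> (observations m X \<omega>) \<longleftrightarrow>
    i \<in> {1..m} \<and> p_value \<sigma> (\<lambda>j. X j \<omega>) i \<le> real (rejections_zeroing a {} \<omega>) * a / real m"
proof -
  have pv: "p_value \<sigma> (observations m X \<omega>) i = p_value \<sigma> (\<lambda>j. X j \<omega>) i" if "i \<in> {1..m}" for i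
    using that by (simp add: p_value_def observations_def)
  then have "num_rejected m a (p_value \<sigma> (observations m X \<omega>)) = rejections_zeroing a {} \<omega>"
    unfolding rejections_zeroing_def by (intro num_rejected_cong) simp
  then show ?thesis using pv by (auto simp: mem_BH_rule_iff[OF assms])
qed

lemma expectation_false_rejections_BH_le:
  assumes a: "0 \<le> a" "a < 1"
  shows "expectation (\<lambda>\<omega>. real (false_rejections m \<nu> X (BH_rule m a \<sigma>) \<omega>)) \<le>
    real m * p / (1 - a) + a / (1 - a)\<^sup>2"
proof -
  have "expectation (\<lambda>\<omega>. real (false_rejections m \<nu> X (BH_rule m a \<sigma>) \<omega>)) \<le>
      expectation (\<lambda>\<omega>. real (rejections_zeroing a {} \<omega>))"
  proof (intro integral_mono' integrable_rejections_zeroing)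
    fix \<omega>
    have "card {i \<in> {1..m}. \<not> \<nu> i \<omega> \<and> i \<in> BH_rule m a \<sigma> (observations m X \<omega>)} \<le>
        card {i \<in> {1..m}. p_value \<sigma> (\<lambda>j. X j \<omega>) i \<le> real (rejections_zeroing a {} \<omega>) * a / real m}"
      by (intro card_mono) (auto simp: mem_BH_rule_observations[OF a(1)])
    also have "\<dots> = rejections_zeroing a {} \<omega>"
      using card_num_rejected[OF a(1), of m "p_value \<sigma> (\<lambda>j. X j \<omega>)"] by (simp add: rejections_zeroing_def)
    finally show "real (false_rejections m \<nu> X (BH_rule m a \<sigma>) \<omega>) \<le> real (rejections_zeroing a {} \<omega>)"
      by (simp add: false_rejections_def)
  qed auto
  also have "\<dots> \<le> real m * p / (1 - a) + a / (1 - a)\<^sup>2"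
    using expectation_rejections_zeroing_le[of "{}" a] a by simp
  finally show ?thesis .
qed

lemma
  shows integrable_small_alternatives: "integrable M (\<lambda>\<omega>. real (card {i \<in> {1..m}. \<nu> i \<omega> \<and> \<bar>X i \<omega>\<bar> < t * \<sigma>}))"
    and expectation_small_alternatives:
      "expectation (\<lambda>\<omega>. real (card {i \<in> {1..m}. \<nu> i \<omega> \<and> \<bar>X i \<omega>\<bar> < t * \<sigma>})) =
        real m * p * central_mass (t / sqrt (1 + u_par \<sigma> \<tau>))"
proof -
  have ev: "{\<omega> \<in> space M. \<nu> i \<omega> \<and> \<bar>X i \<omega>\<bar> < t * \<sigma>} \<in> events" if i: "i \<in> {1..m}" for i
  proof -
    note [measurable] = measurable_nu[OF i] measurable_X[OF i]
    show ?thesis by measurable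
  qed
  show "integrable M (\<lambda>\<omega>. real (card {i \<in> {1..m}. \<nu> i \<omega> \<and> \<bar>X i \<omega>\<bar> < t * \<sigma>}))"
    using ev by (intro integrable_card) auto
  have "\<sigma>\<^sup>2 + \<tau>\<^sup>2 = \<sigma>\<^sup>2 * (1 + u_par \<sigma> \<tau>)" using pos by (simp add: u_par_def field_simps)
  then have s: "sqrt (\<sigma>\<^sup>2 + \<tau>\<^sup>2) = \<sigma> * sqrt (1 + u_par \<sigma> \<tau>)" using pos by (simp add: real_sqrt_mult)
  have sp: "sqrt (\<sigma>\<^sup>2 + \<tau>\<^sup>2) > 0" using pos by (simp add: add_pos_pos)
  have "prob {\<omega> \<in> space M. \<nu> i \<omega> \<and> \<bar>X i \<omega>\<bar> < t * \<sigma>} = p * central_mass (t / sqrt (1 + u_par \<sigma> \<tau>))"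
    if i: "i \<in> {1..m}" for i
    using prob_alternative[OF i, of "{x. \<bar>x\<bar> < t * \<sigma>}"] measure_normal_law_central[OF sp, of "t * \<sigma>"] pos
    by (simp add: s)
  then show "expectation (\<lambda>\<omega>. real (card {i \<in> {1..m}. \<nu> i \<omega> \<and> \<bar>X i \<omega>\<bar> < t * \<sigma>})) =
        real m * p * central_mass (t / sqrt (1 + u_par \<sigma> \<tau>))"
    using ev by (subst expectation_card) auto
qed

text \<open>
  Let \<open>s\<close> be the number of alternatives with \<open>\<bar>X\<^sub>i\<bar> \<ge> t \<sigma>\<close>.  Their p-values are at most
  \<open>2 exp (- t\<^sup>2 / 2)\<close>, so that all of them are rejected if \<open>s \<ge> c\<close>; otherwise there are fewer than
  \<open>c\<close> of them.  In both cases they contribute at most \<open>c\<close> false acceptances.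
\<close>

lemma expectation_false_acceptances_BH_le:
  assumes a: "0 \<le> a" and t: "t \<ge> 0" and c: "c \<ge> 0" "2 * exp (- t\<^sup>2 / 2) \<le> c * a / real m"
  shows "expectation (\<lambda>\<omega>. real (false_acceptances m \<nu> X (BH_rule m a \<sigma>) \<omega>)) \<le>
    real m * p * central_mass (t / sqrt (1 + u_par \<sigma> \<tau>)) + c"
proof -
  let ?small = "\<lambda>\<omega>. {i \<in> {1..m}. \<nu> i \<omega> \<and> \<bar>X i \<omega>\<bar> < t * \<sigma>}"
  have "real (false_acceptances m \<nu> X (BH_rule m a \<sigma>) \<omega>) \<le> real (card (?small \<omega>)) + c" for \<omega>
  proof -
    let ?T = "{i \<in> {1..m}. \<nu> i \<omega> \<and> i \<notin> BH_rule m a \<sigma> (observations m X \<omega>)}"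
    let ?large = "{i \<in> {1..m}. \<nu> i \<omega> \<and> t * \<sigma> \<le> \<bar>X i \<omega>\<bar>}"
    let ?pv = "p_value \<sigma> (\<lambda>j. X j \<omega>)"
    show ?thesis
    proof (cases "c \<le> real (card ?large)")
      case True
      have pv: "?pv i \<le> real (card ?large) * a / real m" if "i \<in> ?large" for i
      proof -
        have "?pv i \<le> 2 * exp (- t\<^sup>2 / 2)"
          using that t pos by (intro p_value_le) auto
        also have "\<dots> \<le> c * a / real m" by (rule c)
        also have "\<dots> \<le> real (card ?large) * a / real m"
          using True a by (intro divide_right_mono mult_right_mono) auto
        finally show ?thesis .
      qed
      have "card ?large \<le> card {1..m}" by (intro card_mono) auto
      moreover have "card ?large \<le> card {i \<in> {1..m}. ?pv i \<le> real (card ?large) * a / real m}"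
        using pv by (intro card_mono) auto
      ultimately have "card ?large \<le> rejections_zeroing a {} \<omega>"
        unfolding rejections_zeroing_def by (intro num_rejected_ge) auto
      then have "real (card ?large) * a / real m \<le> real (rejections_zeroing a {} \<omega>) * a / real m"
        using a by (intro divide_right_mono mult_right_mono) auto
      then have "i \<in> BH_rule m a \<sigma> (observations m X \<omega>)" if "i \<in> ?large" for i
        using pv[OF that] that by (auto simp: mem_BH_rule_observations[OF a])
      then have "?T \<subseteq> ?small \<omega>" by force
      then have "card ?T \<le> card (?small \<omega>)" by (intro card_mono) auto
      then show ?thesis using c by (simp add: false_acceptances_def)
    next
      case False
      have "?T \<subseteq> ?small \<omega> \<union> ?large" by auto
      then have "card ?T \<le> card (?small \<omega> \<union> ?large)" by (intro card_mono) auto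
      also have "\<dots> \<le> card (?small \<omega>) + card ?large" by (rule card_Un_le)
      finally show ?thesis using False by (simp add: false_acceptances_def)
    qed
  qed
  then have "expectation (\<lambda>\<omega>. real (false_acceptances m \<nu> X (BH_rule m a \<sigma>) \<omega>)) \<le>
      expectation (\<lambda>\<omega>. real (card (?small \<omega>)) + c)"
    using c by (intro integral_mono' Bochner_Integration.integrable_add integrable_small_alternatives) auto
  also have "\<dots> = real m * p * central_mass (t / sqrt (1 + u_par \<sigma> \<tau>)) + c"
    by (subst Bochner_Integration.integral_add)
       (simp_all only: integrable_small_alternatives integrable_const expectation_small_alternatives
          prob_space lebesgue_integral_const scaleR_one real_scaleR_def mult_1)
  finally show ?thesis .
qed

text \<open>
  Here \<open>c = e m p\<close> and \<open>t\<^sup>2 = - 2 ln (a e p / 2)\<close> in the preceding lemma; the last summand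
  collects the type I errors.
\<close>

lemma bayes_risk_BH_le:
  assumes \<delta>: "\<delta>\<^sub>0 > 0" "\<delta>\<^sub>A > 0" and a: "0 < a" "a < 1" and e: "e > 0" "a * e * p / 2 \<le> 1"
  shows "bayes_risk m M \<nu> X \<delta>\<^sub>0 \<delta>\<^sub>A (BH_rule m a \<sigma>) \<le> \<delta>\<^sub>A * (real m * p) *
    (central_mass (sqrt (- 2 * ln (a * e * p / 2)) / sqrt (1 + u_par \<sigma> \<tau>)) + e
      + \<delta>\<^sub>0 / \<delta>\<^sub>A * (1 / (1 - a) + a / (1 - a)\<^sup>2 * (1 / (real m * p))))"
proof -
  define t where "t = sqrt (- 2 * ln (a * e * p / 2))"
  have y: "a * e * p / 2 > 0" using a e p by simp
  have mp: "real m * p > 0" using m p by simp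
  have "ln (a * e * p / 2) \<le> 0" using y e by simp
  then have t: "t \<ge> 0" "t\<^sup>2 = - 2 * ln (a * e * p / 2)" by (simp_all add: t_def)
  have "exp (- t\<^sup>2 / 2) = a * e * p / 2" using y by (simp add: t)
  then have "2 * exp (- t\<^sup>2 / 2) \<le> (e * (real m * p)) * a / real m" using m by (simp add: mult_ac)
  then have T: "expectation (\<lambda>\<omega>. real (false_acceptances m \<nu> X (BH_rule m a \<sigma>) \<omega>)) \<le>
      real m * p * central_mass (t / sqrt (1 + u_par \<sigma> \<tau>)) + e * (real m * p)"
    using a t e p by (intro expectation_false_acceptances_BH_le) auto
  have V: "expectation (\<lambda>\<omega>. real (false_rejections m \<nu> X (BH_rule m a \<sigma>) \<omega>)) \<le>
      real m * p / (1 - a) + a / (1 - a)\<^sup>2"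
    using a by (intro expectation_false_rejections_BH_le) auto
  have "bayes_risk m M \<nu> X \<delta>\<^sub>0 \<delta>\<^sub>A (BH_rule m a \<sigma>) \<le>
     \<delta>\<^sub>0 * (real m * p / (1 - a) + a / (1 - a)\<^sup>2) +
     \<delta>\<^sub>A * (real m * p * central_mass (t / sqrt (1 + u_par \<sigma> \<tau>)) + e * (real m * p))"
    unfolding bayes_risk_def using \<delta> by (intro add_mono mult_left_mono T V) auto
  also have "\<dots> = \<delta>\<^sub>A * (real m * p) * (central_mass (t / sqrt (1 + u_par \<sigma> \<tau>)) + e
      + \<delta>\<^sub>0 / \<delta>\<^sub>A * (1 / (1 - a) + a / (1 - a)\<^sup>2 * (1 / (real m * p))))"
  proof -
    have "d0 * (w * k + z) + dA * (w * H + e * w) = dA * w * (H + e + d0 / dA * (k + z * (1 / w)))"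
      if "dA > 0" "w > 0" for d0 dA w k z H :: real
      using that by (simp add: field_simps)
    from this[of \<delta>\<^sub>A "real m * p" \<delta>\<^sub>0 "1 / (1 - a)"] show ?thesis using \<delta> mp by simp
  qed
  finally show ?thesis by (simp add: t_def)
qed

text \<open>
  The left-hand side is the expected cost of the type II errors of the oracle.
\<close>

lemma bayes_risk_oracle_ge:
  assumes \<delta>: "\<delta>\<^sub>0 > 0" "\<delta>\<^sub>A > 0"
  defines "w \<equiv> (1 + 1 / u_par \<sigma> \<tau>) * (ln (v_par p \<sigma> \<tau> \<delta>\<^sub>0 \<delta>\<^sub>A) + ln (1 + 1 / u_par \<sigma> \<tau>))"
  assumes w: "w \<ge> 0"
  shows "\<delta>\<^sub>A * (real m * p) * central_mass (sqrt w / sqrt (1 + u_par \<sigma> \<tau>)) \<le>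
    bayes_risk m M \<nu> X \<delta>\<^sub>0 \<delta>\<^sub>A (bayes_oracle m p \<sigma> \<tau> \<delta>\<^sub>0 \<delta>\<^sub>A)"
proof -
  let ?O = "bayes_oracle m p \<sigma> \<tau> \<delta>\<^sub>0 \<delta>\<^sub>A"
  have iff: "x\<^sup>2 / \<sigma>\<^sup>2 < w \<longleftrightarrow> \<bar>x\<bar> < sqrt w * \<sigma>" for x
  proof -
    have "x\<^sup>2 / \<sigma>\<^sup>2 < w \<longleftrightarrow> x\<^sup>2 < (sqrt w * \<sigma>)\<^sup>2"
      using w pos by (simp add: field_simps power_mult_distrib)
    also have "\<dots> \<longleftrightarrow> \<bar>x\<bar> < sqrt w * \<sigma>"
      using w pos abs_le_square_iff[of "sqrt w * \<sigma>" x] by (simp add: abs_mult not_le[symmetric])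
    finally show ?thesis .
  qed
  have "false_acceptances m \<nu> X ?O \<omega> = card {i \<in> {1..m}. \<nu> i \<omega> \<and> \<bar>X i \<omega>\<bar> < sqrt w * \<sigma>}" for \<omega>
    unfolding false_acceptances_def bayes_oracle_def w_def[symmetric]
    by (intro arg_cong[where f = card]) (auto simp: observations_def iff[symmetric] not_le)
  then have "expectation (\<lambda>\<omega>. real (false_acceptances m \<nu> X ?O \<omega>)) =
      real m * p * central_mass (sqrt w / sqrt (1 + u_par \<sigma> \<tau>))"
    by (simp only: expectation_small_alternatives)
  moreover have "expectation (\<lambda>\<omega>. real (false_rejections m \<nu> X ?O \<omega>)) \<ge> 0" by simp
  ultimately show ?thesis using \<delta> by (simp add: bayes_risk_def)
qed

end

section \<open>The asymptotic thresholds\<close>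

lemma oracle_threshold_limit:
  fixes u v :: "nat \<Rightarrow> real"
  assumes u: "filterlim u at_top sequentially"
    and C: "(\<lambda>m. ln (v m) / u m) \<longlonglongrightarrow> C"
  shows "(\<lambda>m. (1 + 1 / u m) * (ln (v m) + ln (1 + 1 / u m)) / (1 + u m)) \<longlonglongrightarrow> C"
proof -
  have i: "(\<lambda>m. 1 / u m) \<longlonglongrightarrow> 0"
    using tendsto_inverse_0_at_top[OF u] by (simp add: inverse_eq_divide)
  have "(\<lambda>m. ln (v m) / u m + ln (1 + 1 / u m) * (1 / u m)) \<longlonglongrightarrow> C + ln (1 + 0) * 0"
    by (intro tendsto_intros C i) simp
  moreover have "\<forall>\<^sub>F m in sequentially. u m > 0" using u by (rule filterlim_at_top_dense[THEN iffD1, rule_format])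
  then have "\<forall>\<^sub>F m in sequentially. ln (v m) / u m + ln (1 + 1 / u m) * (1 / u m) =
      (1 + 1 / u m) * (ln (v m) + ln (1 + 1 / u m)) / (1 + u m)"
  proof eventually_elim
    case (elim m)
    have "1 + 1 / u m = (1 + u m) / u m" using elim by (simp add: field_simps)
    then have "(1 + 1 / u m) * y / (1 + u m) = y / u m" for y using elim by simp
    then show ?case by (simp add: add_divide_distrib diff_divide_distrib)
  qed
  ultimately show ?thesis by (simp add: filterlim_cong[OF refl refl])
qed

text \<open>
  The squared threshold that guarantees rejection by the step-up rule, and the squared oracle
  threshold, agree to first order.  This uses that \<open>ln (d m)\<close> is negligible against \<open>ln m\<close>,
  while \<open>- ln (p m)\<close> is of the exact order \<open>\<beta> ln m\<close>, and that \<open>ln u\<close> is negligible against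
  \<open>ln v\<close>, since \<open>ln v\<close> is of the order of \<open>u\<close>.
\<close>

lemma BH_threshold_limit:
  fixes p u d :: "nat \<Rightarrow> real"
  defines "v \<equiv> \<lambda>m. u m * ((1 - p m) / p m)\<^sup>2 * (d m)\<^sup>2"
  assumes p: "\<And>m. m \<ge> 1 \<Longrightarrow> 0 < p m \<and> p m < 1" "p \<longlonglongrightarrow> 0"
    and d: "\<And>m. m \<ge> 1 \<Longrightarrow> 0 < d m" "(\<lambda>m. ln (d m)) \<in> o(\<lambda>m. ln (real m))"
    and u: "filterlim u at_top sequentially"
    and C: "(\<lambda>m. ln (v m) / u m) \<longlonglongrightarrow> C" "C > 0"
    and asym: "asymp_proportional p (\<lambda>m. real m powr (- \<beta>))" "0 < \<beta>"
    and a: "a > 0"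
  shows "(\<lambda>m. - 2 * ln (a * d m * p m) / (1 + u m)) \<longlonglongrightarrow> C"
proof -
  have L: "filterlim (\<lambda>m. ln (real m)) at_top sequentially"
    by (rule filterlim_compose[OF ln_at_top filterlim_real_sequentially])
  have inv0: "(\<lambda>m. 1 / g m) \<longlonglongrightarrow> 0" if "filterlim g at_top sequentially" for g :: "nat \<Rightarrow> real"
    using tendsto_inverse_0_at_top[OF that] by (simp add: inverse_eq_divide)
  have ev1: "\<forall>\<^sub>F m in sequentially. m > (1::nat)" by (rule eventually_gt_at_top)
  have evu: "\<forall>\<^sub>F m in sequentially. u m > 0" using u by (rule filterlim_at_top_dense[THEN iffD1, rule_format])
  have d0: "(\<lambda>m. ln (d m) / ln (real m)) \<longlonglongrightarrow> 0" using d(2) by (rule smalloD_tendsto)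
  have p0: "(\<lambda>m. ln (p m) / ln (real m)) \<longlonglongrightarrow> - \<beta>"
  proof -
    from asym obtain c where c: "c > 0" "(\<lambda>m. p m / real m powr (- \<beta>)) \<longlonglongrightarrow> c"
      by (auto simp: asymp_proportional_def)
    have "(\<lambda>m. ln (p m / real m powr (- \<beta>)) * (1 / ln (real m)) - \<beta>) \<longlonglongrightarrow> ln c * 0 - \<beta>"
      using c by (intro tendsto_intros inv0 L) auto
    moreover have "\<forall>\<^sub>F m in sequentially. ln (p m / real m powr (- \<beta>)) * (1 / ln (real m)) - \<beta> = ln (p m) / ln (real m)"
      using ev1
    proof eventually_elim
      case (elim m)
      then have "ln (p m / real m powr (- \<beta>)) = ln (p m) + \<beta> * ln (real m)"
        using p(1)[of m] by (simp add: ln_div ln_powr)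
      moreover have "ln (real m) > 0" using elim by simp
      ultimately show ?case by (simp add: field_simps)
    qed
    ultimately show ?thesis by (simp add: filterlim_cong[OF refl refl])
  qed
  \<comment> \<open>Both \<open>ln v - ln u\<close> and \<open>- 2 ln (a d p)\<close> are asymptotic to \<open>2 \<beta> ln m\<close>.\<close>
  have A: "(\<lambda>m. (ln (v m) - ln (u m)) / ln (real m)) \<longlonglongrightarrow> 2 * \<beta>"
  proof -
    have "(\<lambda>m. 2 * (ln (1 - p m) * (1 / ln (real m)) - ln (p m) / ln (real m) + ln (d m) / ln (real m)))
        \<longlonglongrightarrow> 2 * (ln (1 - 0) * 0 - (- \<beta>) + 0)"
      by (intro tendsto_intros inv0 L p0 d0 p(2)) auto
    moreover have "\<forall>\<^sub>F m in sequentially.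
        2 * (ln (1 - p m) * (1 / ln (real m)) - ln (p m) / ln (real m) + ln (d m) / ln (real m))
        = (ln (v m) - ln (u m)) / ln (real m)"
      using ev1 evu
    proof eventually_elim
      case (elim m)
      then have "ln (v m) = ln (u m) + 2 * (ln (1 - p m) - ln (p m) + ln (d m))"
        using p(1)[of m] d(1)[of m] unfolding v_def
        by (simp add: ln_mult ln_div ln_realpow)
      then show ?case by (simp add: add_divide_distrib diff_divide_distrib)
    qed
    ultimately show ?thesis by (simp add: filterlim_cong[OF refl refl])
  qed
  have B: "(\<lambda>m. - 2 * ln (a * d m * p m) / ln (real m)) \<longlonglongrightarrow> 2 * \<beta>"
  proof -
    have "(\<lambda>m. - 2 * (ln a * (1 / ln (real m)) + ln (d m) / ln (real m) + ln (p m) / ln (real m)))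
        \<longlonglongrightarrow> - 2 * (ln a * 0 + 0 + (- \<beta>))"
      by (intro tendsto_intros inv0 L p0 d0)
    moreover have "\<forall>\<^sub>F m in sequentially.
        - 2 * (ln a * (1 / ln (real m)) + ln (d m) / ln (real m) + ln (p m) / ln (real m))
        = - 2 * ln (a * d m * p m) / ln (real m)"
      using ev1
    proof eventually_elim
      case (elim m)
      then have "ln (a * d m * p m) = ln a + ln (d m) + ln (p m)"
        using p(1)[of m] d(1)[of m] a by (simp add: ln_mult)
      then show ?case by (simp add: add_divide_distrib diff_divide_distrib)
    qed
    ultimately show ?thesis by (simp add: filterlim_cong[OF refl refl])
  qed
  have lnu: "(\<lambda>m. ln (u m) / u m) \<longlonglongrightarrow> 0"
    by (rule filterlim_compose[OF ln_x_over_x_tendsto_0 u])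
  have "(\<lambda>m. ((- 2 * ln (a * d m * p m) / ln (real m)) / ((ln (v m) - ln (u m)) / ln (real m)))
      * (ln (v m) / u m - ln (u m) / u m) * (1 / (1 / u m + 1))) \<longlonglongrightarrow> (2 * \<beta> / (2 * \<beta>)) * (C - 0) * (1 / (0 + 1))"
    using asym(2) by (intro tendsto_intros A B C(1) lnu inv0 u) auto
  moreover have "\<forall>\<^sub>F m in sequentially. (ln (v m) - ln (u m)) / ln (real m) > 0"
    using order_tendstoD(1)[OF A, of 0] asym(2) by simp
  then have "\<forall>\<^sub>F m in sequentially. ((- 2 * ln (a * d m * p m) / ln (real m)) / ((ln (v m) - ln (u m)) / ln (real m)))
      * (ln (v m) / u m - ln (u m) / u m) * (1 / (1 / u m + 1)) = - 2 * ln (a * d m * p m) / (1 + u m)"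
    using ev1 evu
  proof eventually_elim
    case (elim m)
    have e: "x / l / (y / l) * (w / z - t / z) * (1 / (1 / z + 1)) = x / (1 + z)"
      if "l > 0" "z > 0" "y \<noteq> 0" "y = w - t" for x l y w z t :: real
    proof -
      have "w / z - t / z = y / z" using that by (simp add: diff_divide_distrib)
      moreover have "1 / (1 / z + 1) = z / (1 + z)" using that by (simp add: field_simps)
      ultimately show ?thesis using that by simp
    qed
    have "ln (real m) > 0" using elim by simp
    moreover from this have "ln (v m) - ln (u m) \<noteq> 0" using elim by auto
    ultimately show ?case using elim by (intro e) auto
  qed
  ultimately have "(\<lambda>m. - 2 * ln (a * d m * p m) / (1 + u m)) \<longlonglongrightarrow> (2 * \<beta> / (2 * \<beta>)) * (C - 0) * (1 / (0 + 1))"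
    by (rule Lim_transform_eventually)
  then show ?thesis using asym(2) by simp
qed

section \<open>Asymptotic optimality\<close>

theorem corollary5p2:
  fixes M :: "nat \<Rightarrow> 'a measure"
    and \<nu> :: "nat \<Rightarrow> nat \<Rightarrow> 'a \<Rightarrow> bool"
    and X :: "nat \<Rightarrow> nat \<Rightarrow> 'a \<Rightarrow> real"
    and p \<sigma> \<tau> \<delta>\<^sub>0 \<delta>\<^sub>A :: "nat \<Rightarrow> real"
    and C \<beta> \<alpha> :: real
  assumes "\<And>m. m \<ge> 1 \<Longrightarrow> 0 < p m \<and> p m < 1"
    and "\<And>m. m \<ge> 1 \<Longrightarrow> \<sigma> m > 0"
    and "\<And>m. m \<ge> 1 \<Longrightarrow> \<tau> m > 0"
    and "\<And>m. m \<ge> 1 \<Longrightarrow> \<delta>\<^sub>0 m > 0"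
    and "\<And>m. m \<ge> 1 \<Longrightarrow> \<delta>\<^sub>A m > 0"
    and "\<And>m. m \<ge> 1 \<Longrightarrow> mixture_model m (M m) (\<nu> m) (X m) (p m) (\<sigma> m) (\<tau> m)"
    and "p \<longlonglongrightarrow> 0"
    and "filterlim (\<lambda>m. u_par (\<sigma> m) (\<tau> m)) at_top sequentially"
    and "filterlim (\<lambda>m. v_par (p m) (\<sigma> m) (\<tau> m) (\<delta>\<^sub>0 m) (\<delta>\<^sub>A m)) at_top sequentially"
    and "(\<lambda>m. ln (v_par (p m) (\<sigma> m) (\<tau> m) (\<delta>\<^sub>0 m) (\<delta>\<^sub>A m)) / u_par (\<sigma> m) (\<tau> m)) \<longlonglongrightarrow> C"
    and "C > 0"
    and "asymp_proportional p (\<lambda>m. real m powr (- \<beta>))"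
    and "0 < \<beta>" and "\<beta> \<le> 1"
    and "0 < \<alpha>" and "\<alpha> < 1"
    and "(\<lambda>m. \<delta>\<^sub>0 m / \<delta>\<^sub>A m) \<longlonglongrightarrow> 0"
    and "(\<lambda>m. ln (\<delta>\<^sub>0 m / \<delta>\<^sub>A m)) \<in> o(\<lambda>m. ln (real m))"
  shows "ABOS
           (\<lambda>m. bayes_risk m (M m) (\<nu> m) (X m) (\<delta>\<^sub>0 m) (\<delta>\<^sub>A m) (BH_rule m \<alpha> (\<sigma> m)))
           (\<lambda>m. bayes_risk m (M m) (\<nu> m) (X m) (\<delta>\<^sub>0 m) (\<delta>\<^sub>A m)
                  (bayes_oracle m (p m) (\<sigma> m) (\<tau> m) (\<delta>\<^sub>0 m) (\<delta>\<^sub>A m)))"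
proof -
  note p = assms(1) and \<sigma> = assms(2) and \<tau> = assms(3) and \<delta>\<^sub>0 = assms(4) and \<delta>\<^sub>A = assms(5)
    and model = assms(6) and p0 = assms(7) and u_lim = assms(8)
    and C_lim = assms(10) and C = assms(11) and asym = assms(12) and \<beta> = assms(13,14)
    and \<alpha> = assms(15,16) and d0 = assms(17) and ln_d = assms(18)
  define u where "u m = u_par (\<sigma> m) (\<tau> m)" for m
  define v where "v m = v_par (p m) (\<sigma> m) (\<tau> m) (\<delta>\<^sub>0 m) (\<delta>\<^sub>A m)" for m
  define d where "d m = \<delta>\<^sub>0 m / \<delta>\<^sub>A m" for m
  define w where "w m = (1 + 1 / u m) * (ln (v m) + ln (1 + 1 / u m))" for m
  define y where "y m = \<alpha> * d m * p m / 2" for m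
  define BH where "BH m = bayes_risk m (M m) (\<nu> m) (X m) (\<delta>\<^sub>0 m) (\<delta>\<^sub>A m) (BH_rule m \<alpha> (\<sigma> m))" for m
  define Or where "Or m = bayes_risk m (M m) (\<nu> m) (X m) (\<delta>\<^sub>0 m) (\<delta>\<^sub>A m)
    (bayes_oracle m (p m) (\<sigma> m) (\<tau> m) (\<delta>\<^sub>0 m) (\<delta>\<^sub>A m))" for m
  define lo where "lo m = central_mass (sqrt (w m) / sqrt (1 + u m))" for m
  define up where "up m = central_mass (sqrt (- 2 * ln (y m)) / sqrt (1 + u m)) + d m
    + d m * (1 / (1 - \<alpha>) + \<alpha> / (1 - \<alpha>)\<^sup>2 * (1 / (real m * p m)))" for m
  let ?D = "central_mass (sqrt C)"
  have D: "?D > 0" using C by (simp add: central_mass_pos)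
  have u_lim: "filterlim u at_top sequentially" using u_lim by (simp add: u_def[abs_def])
  have C_lim: "(\<lambda>m. ln (v m) / u m) \<longlonglongrightarrow> C" using C_lim by (simp add: u_def v_def)
  have d0: "d \<longlonglongrightarrow> 0" using d0 by (simp add: d_def[abs_def])
  have d_pos: "d m > 0" if "m \<ge> 1" for m using \<delta>\<^sub>0[OF that] \<delta>\<^sub>A[OF that] by (simp add: d_def)
  have v_eq: "v = (\<lambda>m. u m * ((1 - p m) / p m)\<^sup>2 * (d m)\<^sup>2)"
    by (simp add: fun_eq_iff v_def v_par_def u_def f_par_def d_def)

  have w_lim: "(\<lambda>m. w m / (1 + u m)) \<longlonglongrightarrow> C"
    unfolding w_def by (rule oracle_threshold_limit[OF u_lim C_lim])
  have y_lim: "(\<lambda>m. - 2 * ln (y m) / (1 + u m)) \<longlonglongrightarrow> C"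
  proof -
    have "(\<lambda>m. ln (d m)) \<in> o(\<lambda>m. ln (real m))" using ln_d by (simp add: d_def)
    moreover have "y = (\<lambda>m. \<alpha> / 2 * d m * p m)" by (simp add: fun_eq_iff y_def)
    moreover have "\<alpha> / 2 > 0" using \<alpha> by simp
    ultimately show ?thesis
      using BH_threshold_limit[of p d u C \<beta> "\<alpha> / 2", OF p p0 d_pos _ u_lim C_lim[unfolded v_eq] C asym \<beta>(1)]
      by blast
  qed
  have lo_lim: "lo \<longlonglongrightarrow> ?D"
    unfolding lo_def real_sqrt_divide[symmetric]
    using C by (intro tendsto_central_mass tendsto_real_sqrt w_lim) auto
  have up_lim: "up \<longlonglongrightarrow> ?D"
  proof -
    from asym obtain c where c: "c > 0" "(\<lambda>m. p m / real m powr (- \<beta>)) \<longlonglongrightarrow> c"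
      by (auto simp: asymp_proportional_def)
    have "\<forall>\<^sub>F m in sequentially. c / 2 < p m / real m powr (- \<beta>)"
      using order_tendstoD(1)[OF c(2), of "c / 2"] c(1) by simp
    then have le: "\<forall>\<^sub>F m in sequentially. d m * (1 / (real m * p m)) \<le> d m * (2 / c)"
      using eventually_ge_at_top[of 1]
    proof eventually_elim
      case (elim m)
      \<comment> \<open>As \<open>\<beta> \<le> 1\<close>, the expected number \<open>m p\<close> of alternatives is bounded away from \<open>0\<close>.\<close>
      have "c / 2 * real m powr (- 1) \<le> c / 2 * real m powr (- \<beta>)"
        using elim c(1) \<beta> by (intro mult_left_mono powr_mono) auto
      also have "\<dots> < p m" using elim by (simp add: field_simps)
      finally have "c / 2 < real m * p m" using elim by (simp add: powr_minus field_simps)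
      then have "1 / (real m * p m) \<le> 2 / c" using c(1) elim by (simp add: field_simps)
      then show ?case using d_pos[of m] elim by (intro mult_left_mono) auto
    qed
    have ge: "\<forall>\<^sub>F m in sequentially. 0 \<le> d m * (1 / (real m * p m))"
      using eventually_ge_at_top[of 1] by eventually_elim (use d_pos p in \<open>simp add: less_imp_le\<close>)
    have lim: "(\<lambda>m. d m * (2 / c)) \<longlonglongrightarrow> 0" by (rule tendsto_mult_left_zero[OF d0])
    have dmp: "(\<lambda>m. d m * (1 / (real m * p m))) \<longlonglongrightarrow> 0"
      by (rule tendsto_sandwich[OF ge le tendsto_const lim])
    have "(\<lambda>m. central_mass (sqrt (- 2 * ln (y m) / (1 + u m))) + d m
        + (d m * (1 / (1 - \<alpha>)) + \<alpha> / (1 - \<alpha>)\<^sup>2 * (d m * (1 / (real m * p m)))))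
      \<longlonglongrightarrow> ?D + 0 + (0 * (1 / (1 - \<alpha>)) + \<alpha> / (1 - \<alpha>)\<^sup>2 * 0)"
      using C by (intro tendsto_add tendsto_mult tendsto_const tendsto_central_mass tendsto_real_sqrt
          y_lim d0 dmp) simp
    moreover have "up = (\<lambda>m. central_mass (sqrt (- 2 * ln (y m) / (1 + u m))) + d m
        + (d m * (1 / (1 - \<alpha>)) + \<alpha> / (1 - \<alpha>)\<^sup>2 * (d m * (1 / (real m * p m)))))"
      by (rule ext) (simp only: up_def real_sqrt_divide distrib_left mult.left_commute)
    ultimately show ?thesis by simp
  qed

  have "\<forall>\<^sub>F m in sequentially. w m / (1 + u m) > 0" using order_tendstoD(1)[OF w_lim C] .
  moreover have "\<forall>\<^sub>F m in sequentially. lo m > 0" using order_tendstoD(1)[OF lo_lim D] .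
  moreover have "\<forall>\<^sub>F m in sequentially. d m < 1" using order_tendstoD(2)[OF d0] by simp
  ultimately have ev: "\<forall>\<^sub>F m in sequentially. 1 \<le> BH m / Or m \<and> BH m / Or m \<le> up m / lo m"
    using eventually_ge_at_top[of 1]
  proof eventually_elim
    case (elim m)
    interpret tg: two_groups "M m" m "\<nu> m" "X m" "p m" "\<sigma> m" "\<tau> m"
      using model[of m] p[of m] \<sigma>[of m] \<tau>[of m] elim
      by (intro two_groups.intro two_groups_axioms.intro) (auto simp: mixture_model_def)
    have pm: "0 < p m" "p m < 1" and \<delta>: "\<delta>\<^sub>0 m > 0" "\<delta>\<^sub>A m > 0" and dm: "d m > 0"
      using p[of m] \<delta>\<^sub>0[of m] \<delta>\<^sub>A[of m] d_pos[of m] elim by auto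
    let ?K = "\<delta>\<^sub>A m * (real m * p m)"
    have K: "?K > 0" using \<delta> pm elim by simp
    have "u m > 0" using \<sigma>[of m] \<tau>[of m] elim by (simp add: u_def u_par_def)
    then have "w m > 0" using elim by (simp add: zero_less_divide_iff)
    then have lower: "?K * lo m \<le> Or m"
      using tg.bayes_risk_oracle_ge[OF \<delta>] unfolding lo_def Or_def w_def u_def v_def by simp
    have "\<alpha> * d m * p m / 2 \<le> 1"
    proof -
      have "\<alpha> * d m * p m \<le> 1 * 1 * 1" using \<alpha> dm pm elim by (intro mult_mono) auto
      then show ?thesis by simp
    qed
    then have upper: "BH m \<le> ?K * up m"
      using tg.bayes_risk_BH_le[OF \<delta> \<alpha> dm] unfolding BH_def up_def y_def u_def d_def by simp
    have opt: "Or m \<le> BH m"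
      unfolding Or_def BH_def using pm \<delta> \<sigma>[of m] \<tau>[of m] model[of m] \<alpha> elim
      by (intro bayes_oracle_minimizes_risk measurable_rule_BH) auto
    have lo: "?K * lo m > 0" using K elim by simp
    then have "1 \<le> BH m / Or m" using opt lower by (simp add: le_divide_eq)
    moreover have "BH m / Or m \<le> (?K * up m) / (?K * lo m)"
      using lo lower upper opt by (intro frac_le) auto
    moreover have "(?K * up m) / (?K * lo m) = up m / lo m"
      by (rule mult_divide_mult_cancel_left[OF less_imp_neq[OF K, symmetric]])
    ultimately show ?case by simp
  qed
  have lim: "(\<lambda>m. up m / lo m) \<longlonglongrightarrow> 1"
    using tendsto_divide[OF up_lim lo_lim] D by simp
  have "(\<lambda>m. BH m / Or m) \<longlonglongrightarrow> 1"
    by (rule tendsto_sandwich[OF _ _ tendsto_const lim]) (use ev in \<open>auto elim: eventually_mono\<close>)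
  then show ?thesis by (simp add: ABOS_def BH_def Or_def)
qed

end
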